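(* Let $\mathbb{G}$ be an H-type (Heisenberg type) group with Lie algebra $\mathcal{G}=V_1\oplus V_2$ and homogeneous dimension $Q=m+2k$, where $m=\dim V_1$ and $k=\dim V_2$. Let $K(x)=(|v(x)|^4+16|z(x)|^2)^{1/4}$ and let $\alpha\in\mathbb{R}$. Then for every (real-valued) $\phi\in C_0^\infty(\mathbb{G}\setminus\{0\})$, $$\int_{\mathbb{G}}K^{\alpha}|\nabla_{\mathbb{G}}\phi|^2\,dx\ \ge\ \Big(\frac{Q+\alpha-2}{2}\Big)^2\int_{\mathbb{G}}K^{\alpha}\,\frac{|v|^2}{K^4}\,\phi^2\,dx .$$ Moreover, the constant $\big(\frac{Q+\alpha-2}{2}\big)^2$ is sharp, i.e. it cannot be replaced by any larger constant so that the inequality still holds for all such $\phi$.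
   Context: A Carnot group of step two is a connected, simply connected nilpotent Lie group $\mathbb{G}$ whose Lie algebra has a decomposition $\mathcal{G}=V_1\oplus V_2$ with $[V_1,V_1]=V_2$ and $[V_1,V_2]=0$. An H-type group is a Carnot group with a two-step Lie algebra $\mathcal{G}=V_1\oplus V_2$ and an inner product $\langle\cdot,\cdot\rangle$ on $\mathcal{G}$ such that the linear map $J:V_2\to\mathrm{End}(V_1)$ defined by $\langle J_z(u),v\rangle=\langle z,[u,v]\rangle$ for $u,v\in V_1$, $z\in V_2$, satisfies $J_z^2=-\|z\|^2\,\mathbf{Id}$ for all $z\in V_2$, where $\|z\|^2=\langle z,z\rangle$. The exponential map is an analytic diffeomorphism, and the analytic maps $v:\mathbb{G}\to V_1$, $z:\mathbb{G}\to V_2$ are defined by $x=\exp(v(x)+z(x))$; $|v(x)|$ and $|z(x)|$ are the norms induced by the inner product. $X_1,\dots,X_m$ are the left-invariant vector fields given by a fixed orthonormal basis of $V_1$; $\nabla_{\mathbb{G}}=(X_1,\dots,X_m)$ is the horizontal gradient and $|\nabla_{\mathbb{G}}\phi|^2=\sum_{i=1}^m (X_i\phi)^2$. $0$ denotes the neutral element of $\mathbb{G}$, $dx$ is Haar measure (Lebesgue measure in exponential coordinates), and $C_0^\infty(\mathbb{G}\setminus\{0\})$ is the space of smooth functions with compact support in $\mathbb{G}\setminus\{0\}$. The value of the left-hand integral is allowed to be $+\infty$. *)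

theory Defs
  imports "HOL-Analysis.Analysis"
begin

section \<open>H-type Lie algebras\<close>

locale lie_algebra =
  fixes br :: "'g::euclidean_space \<Rightarrow> 'g \<Rightarrow> 'g"
  assumes bilinear_br: "bilinear br"
    and br_self: "br x x = 0"
    and jacobi: "br x (br y z) + br y (br z x) + br z (br x y) = 0"

text \<open>
  The algebra \<open>V\<^sub>1 \<oplus> V\<^sub>2\<close> is the whole type \<open>'g\<close>. The inner product is only needed for the
  H-type condition below; the two layers are not required to be orthogonal to each other. A
  bracket of two subspaces is the span of the brackets of their elements.
  That \<open>[V\<^sub>2, V\<^sub>2] = 0\<close> follows from the Jacobi identity.
\<close>

locale two_step_algebra = lie_algebra br
  for br :: "'g::euclidean_space \<Rightarrow> 'g \<Rightarrow> 'g" +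
  fixes V1 V2 :: "'g set"
  assumes subspace_V1: "subspace V1"
    and subspace_V2: "subspace V2"
    and V1_Int_V2: "V1 \<inter> V2 = {0}"
    and V1_plus_V2: "{u + w | u w. u \<in> V1 \<and> w \<in> V2} = UNIV"
    and br_V1_V1: "span {br u u' | u u'. u \<in> V1 \<and> u' \<in> V1} = V2"
    and br_V1_V2: "u \<in> V1 \<Longrightarrow> w \<in> V2 \<Longrightarrow> br u w = 0"

text \<open>The vector \<open>J\<^sub>z u\<close> of \<open>V\<^sub>1\<close>, defined by duality.\<close>

definition J_map :: "('g::euclidean_space \<Rightarrow> 'g \<Rightarrow> 'g) \<Rightarrow> 'g set \<Rightarrow> 'g \<Rightarrow> 'g \<Rightarrow> 'g" where
  "J_map br V1 z u = (THE w. w \<in> V1 \<and> (\<forall>v\<in>V1. w \<bullet> v = z \<bullet> br u v))"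

locale H_type_algebra = two_step_algebra br V1 V2
  for br :: "'g::euclidean_space \<Rightarrow> 'g \<Rightarrow> 'g" and V1 V2 :: "'g set" +
  assumes J_square: "z \<in> V2 \<Longrightarrow> u \<in> V1 \<Longrightarrow>
    J_map br V1 z (J_map br V1 z u) = - ((norm z)\<^sup>2 *\<^sub>R u)"

definition homogeneous_dim :: "'g::euclidean_space set \<Rightarrow> 'g set \<Rightarrow> nat" where
  "homogeneous_dim V1 V2 = dim V1 + 2 * dim V2"

definition orthonormal_basis_of :: "'g::euclidean_space set \<Rightarrow> 'g set \<Rightarrow> bool" where
  "orthonormal_basis_of E V \<longleftrightarrow>
     pairwise orthogonal E \<and> (\<forall>e\<in>E. norm e = 1) \<and> span E = V"

section \<open>The group\<close>

text \<open>
  The connected, simply connected group of a nilpotent Lie algebra is taken in exponential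
  coordinates: its points are the elements of the algebra, \<open>exp\<close> is the identity map, and the
  product is given by the Baker-Campbell-Hausdorff formula, which in step two ends after the first
  commutator. Haar measure is then \<^term>\<open>lborel\<close>, and the neutral element is \<open>0\<close>.
\<close>

definition gmult :: "('g::euclidean_space \<Rightarrow> 'g \<Rightarrow> 'g) \<Rightarrow> 'g \<Rightarrow> 'g \<Rightarrow> 'g" where
  "gmult br x y = x + y + (1/2) *\<^sub>R br x y"

definition v_part :: "'g::euclidean_space set \<Rightarrow> 'g set \<Rightarrow> 'g \<Rightarrow> 'g" where
  "v_part V1 V2 x = (THE v. v \<in> V1 \<and> x - v \<in> V2)"

definition z_part :: "'g::euclidean_space set \<Rightarrow> 'g set \<Rightarrow> 'g \<Rightarrow> 'g" where
  "z_part V1 V2 x = (THE z. z \<in> V2 \<and> x - z \<in> V1)"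

definition K_gauge :: "'g::euclidean_space set \<Rightarrow> 'g set \<Rightarrow> 'g \<Rightarrow> real" where
  "K_gauge V1 V2 x = (norm (v_part V1 V2 x) ^ 4 + 16 * (norm (z_part V1 V2 x))\<^sup>2) powr (1/4)"

text \<open>The left-invariant vector field generated by \<open>e\<close>: differentiation along \<open>x \<cdot> exp (t e)\<close>.\<close>

definition left_inv_field ::
  "('g::euclidean_space \<Rightarrow> 'g \<Rightarrow> 'g) \<Rightarrow> 'g \<Rightarrow> ('g \<Rightarrow> real) \<Rightarrow> 'g \<Rightarrow> real" where
  "left_inv_field br e f x = deriv (\<lambda>t::real. f (gmult br x (t *\<^sub>R e))) 0"

definition hgrad_norm_sq ::
  "('g::euclidean_space \<Rightarrow> 'g \<Rightarrow> 'g) \<Rightarrow> 'g set \<Rightarrow> ('g \<Rightarrow> real) \<Rightarrow> 'g \<Rightarrow> real" where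
  "hgrad_norm_sq br E f x = (\<Sum>e\<in>E. (left_inv_field br e f x)\<^sup>2)"

section \<open>Test functions\<close>

fun C_fun :: "nat \<Rightarrow> ('g::euclidean_space \<Rightarrow> real) \<Rightarrow> bool" where
  "C_fun 0 f \<longleftrightarrow> continuous_on UNIV f"
| "C_fun (Suc n) f \<longleftrightarrow>
     (\<forall>x. f differentiable (at x)) \<and> (\<forall>h. C_fun n (\<lambda>x. frechet_derivative f (at x) h))"

text \<open>
  An element of \<open>C\<^sub>0\<^sup>\<infinity>(G \<setminus> {0})\<close> is represented by its extension by zero to the whole group, which is
  smooth because the support is a compact set avoiding \<open>0\<close>.
\<close>

definition test_funs :: "('g::euclidean_space \<Rightarrow> real) set" where
  "test_funs = {f. (\<forall>n. C_fun n f) \<and> compact (closure {x. f x \<noteq> 0}) \<and> 0 \<notin> closure {x. f x \<noteq> 0}}"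

section \<open>The two sides of the inequality\<close>

text \<open>
  All integrands are nonnegative, so the integrals are Lebesgue integrals with values in
  \<open>[0, \<infinity>]\<close>.
\<close>

definition hardy_lhs ::
  "('g::euclidean_space \<Rightarrow> 'g \<Rightarrow> 'g) \<Rightarrow> 'g set \<Rightarrow> 'g set \<Rightarrow> 'g set \<Rightarrow> real \<Rightarrow> ('g \<Rightarrow> real) \<Rightarrow> ennreal" where
  "hardy_lhs br V1 V2 E \<alpha> \<phi> =
     (\<integral>\<^sup>+x. ennreal (K_gauge V1 V2 x powr \<alpha> * hgrad_norm_sq br E \<phi> x) \<partial>lborel)"

definition hardy_rhs ::
  "'g::euclidean_space set \<Rightarrow> 'g set \<Rightarrow> real \<Rightarrow> ('g \<Rightarrow> real) \<Rightarrow> ennreal" where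
  "hardy_rhs V1 V2 \<alpha> \<phi> =
     (\<integral>\<^sup>+x. ennreal (K_gauge V1 V2 x powr \<alpha> *
        ((norm (v_part V1 V2 x))\<^sup>2 / K_gauge V1 V2 x ^ 4) * (\<phi> x)\<^sup>2) \<partial>lborel)"

section \<open>The descriptions above determine unique objects\<close>

context two_step_algebra
begin

lemma ex1_v_part: "\<exists>!v. v \<in> V1 \<and> x - v \<in> V2"
proof -
  have "x \<in> {u + w | u w. u \<in> V1 \<and> w \<in> V2}" by (simp only: V1_plus_V2 UNIV_I)
  then obtain u w where *: "x = u + w" "u \<in> V1" "w \<in> V2" by blast
  have "v = u" if "v \<in> V1" "x - v \<in> V2" for v
  proof -
    have "v - u \<in> V1" using subspace_diff[OF subspace_V1 that(1) *(2)] .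
    moreover have "w - (x - v) \<in> V2" using subspace_diff[OF subspace_V2 *(3) that(2)] .
    ultimately have "v - u \<in> V1 \<inter> V2" using *(1) by simp
    then show ?thesis using V1_Int_V2 by auto
  qed
  with * show ?thesis by (intro ex1I[of _ u]) auto
qed

lemma ex1_z_part: "\<exists>!z. z \<in> V2 \<and> x - z \<in> V1"
proof -
  obtain v where v: "v \<in> V1" "x - v \<in> V2"
    using ex1_v_part[of x] by blast
  show ?thesis
  proof (rule ex1I[of _ "x - v"])
    show "x - v \<in> V2 \<and> x - (x - v) \<in> V1" using v by simp
  next
    fix z assume z: "z \<in> V2 \<and> x - z \<in> V1"
    then have "x - z \<in> V1 \<and> x - (x - z) \<in> V2" by simp
    then have "x - z = v" using ex1_v_part[of x] v by blast
    then show "z = x - v" by (simp add: algebra_simps)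
  qed
qed

lemma ex1_J_map: "\<exists>!w. w \<in> V1 \<and> (\<forall>v\<in>V1. w \<bullet> v = z \<bullet> br u v)"
proof -
  obtain B where B: "B \<subseteq> V1" "pairwise orthogonal B" "\<And>x. x \<in> B \<Longrightarrow> norm x = 1"
      "independent B" "span B = V1"
    using orthonormal_basis_subspace[OF subspace_V1] by metis
  have fB: "finite B" using B(4) by (rule independent_imp_finite)
  define w where "w = (\<Sum>b\<in>B. (z \<bullet> br u b) *\<^sub>R b)"
  have lin: "linear (\<lambda>v. z \<bullet> br u v)"
    using bilinear_br unfolding bilinear_def
    by (auto simp: linear_iff inner_add_right)
  have "w \<in> V1" unfolding w_def using B(1)
    by (intro subspace_sum[OF subspace_V1] subspace_scale[OF subspace_V1]) (rule subsetD)
  moreover have "w \<bullet> v = z \<bullet> br u v" if "v \<in> V1" for v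
  proof -
    have v: "(\<Sum>b\<in>B. (v \<bullet> b) *\<^sub>R b) = v"
      using orthonormal_basis_expand[of B v] B fB that by simp
    have "z \<bullet> br u (\<Sum>b\<in>B. (v \<bullet> b) *\<^sub>R b) = (\<Sum>b\<in>B. (v \<bullet> b) * (z \<bullet> br u b))"
      using linear_sum[OF lin, of "\<lambda>b. (v \<bullet> b) *\<^sub>R b" B] linear_cmul[OF lin] by simp
    then have "z \<bullet> br u v = (\<Sum>b\<in>B. (v \<bullet> b) * (z \<bullet> br u b))"
      by (simp only: v)
    then show ?thesis unfolding w_def inner_sum_left inner_scaleR_left by (simp only: inner_commute mult.commute)
  qed
  moreover have "w' = w''" if "w' \<in> V1" "w'' \<in> V1" "\<forall>v\<in>V1. w' \<bullet> v = z \<bullet> br u v"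
      "\<forall>v\<in>V1. w'' \<bullet> v = z \<bullet> br u v" for w' w''
  proof -
    have "w' - w'' \<in> V1" using subspace_diff[OF subspace_V1 that(1,2)] .
    then have "(w' - w'') \<bullet> (w' - w'') = 0"
      using that(3,4) by (simp add: inner_diff_left)
    then show ?thesis by simp
  qed
  ultimately show ?thesis by (intro ex1I[of _ w]) simp_all
qed

end

end

theory Submission
  imports Defs "HOL-Computational_Algebra.Polynomial"
begin

text \<open>
  Write \<open>N = |v|\<^sup>4 + 16 |z|\<^sup>2 = K\<^sup>4\<close> and \<open>X\<^sub>e\<close> for the left-invariant field of a basis vector \<open>e\<close>.
  The H-type condition says that \<open>J\<^sub>z\<close> multiplies lengths by \<open>|z|\<close> and turns every vector into an
  orthogonal one. It yields the two identities on which everything rests: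
  \<open>\<Sum>\<^sub>e (X\<^sub>e N)\<^sup>2 = 16 |v|\<^sup>2 N\<close> (\<open>sum_XN_sq\<close>) and \<open>\<Sum>\<^sub>e X\<^sub>e X\<^sub>e N = 4 (Q + 2) |v|\<^sup>2\<close> (\<open>sum_XXN\<close>).

  The fields \<open>X\<^sub>e\<close> are divergence free, because they are affine with a nilpotent linear part, so that
  \<open>X\<^sub>e f\<close> has integral zero for every compactly supported \<open>C\<^sup>1\<close> function \<open>f\<close>. Taking
  \<open>f = h N\<^sup>s X\<^sub>e N\<close> and summing over \<open>e\<close> gives, for \<open>h\<close> supported away from the origin,
  \<open>\<integral> N\<^sup>s \<Sum>\<^sub>e X\<^sub>e h X\<^sub>e N = - 4 (4 s + Q + 2) \<integral> N\<^sup>s |v|\<^sup>2 h\<close>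
  (\<open>weighted_divergence_theorem\<close>). This single identity gives both halves of the result.

  For the inequality, put \<open>l = (Q + \<alpha> - 2) / 2\<close>, \<open>s = \<alpha>/4 - 1\<close> and \<open>h = \<phi>\<^sup>2\<close>. Expanding the square in
  \<open>0 \<le> N\<^sup>s \<Sum>\<^sub>e N (X\<^sub>e \<phi> + l \<phi> X\<^sub>e N / (4 N))\<^sup>2\<close> and integrating, the mixed term is evaluated by the
  identity and equals \<open>-2 l\<^sup>2\<close> times the right-hand integral, while the last term contributes
  \<open>+ l\<^sup>2\<close> times that integral.

  The square vanishes for \<open>\<phi> = N\<^sup>-\<^sup>l\<^sup>/\<^sup>4\<close>, which is not a test function but suggests
  \<open>\<phi> = N\<^sup>-\<^sup>l\<^sup>/\<^sup>4 g(ln N)\<close> for optimality. The two integrals then become one-dimensional: with \<open>\<nu>\<close> the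
  image of the measure \<open>N\<^sup>q |v|\<^sup>2 dx\<close>, \<open>q = -(Q + 2)/4\<close>, under \<open>ln N\<close>, they are
  \<open>16 \<integral> g'\<^sup>2 d\<nu> + l\<^sup>2 \<integral> g\<^sup>2 d\<nu>\<close> and \<open>\<integral> g\<^sup>2 d\<nu>\<close>. The exponent \<open>q\<close> is the one for which the factor
  \<open>4 q + Q + 2\<close> in the identity vanishes, so \<open>\<integral> g' d\<nu> = 0\<close> for every compactly supported
  \<open>C\<^sup>1\<close> function \<open>g\<close>; in
  other words \<open>\<nu>\<close> is translation invariant. Hence for a plateau \<open>g\<close> of height one and length \<open>n\<close> with
  fixed flanks, \<open>\<integral> g'\<^sup>2 d\<nu>\<close> stays bounded while \<open>\<integral> g\<^sup>2 d\<nu>\<close> grows linearly in \<open>n\<close>, and no constant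
  larger than \<open>l\<^sup>2\<close> is possible.
\<close>

section \<open>Smooth functions on open sets\<close>

text \<open>
  The weights \<open>N\<^sup>s\<close> are smooth only away from the origin. Since \<^const>\<open>frechet_derivative\<close> is taken at
  a point of the whole space, the clauses of \<^const>\<open>C_fun\<close> can be restricted to a set, and smoothness
  becomes a local property that can be glued over open sets.
\<close>

fun C_on :: "'a::euclidean_space set \<Rightarrow> nat \<Rightarrow> ('a \<Rightarrow> real) \<Rightarrow> bool" where
  "C_on S 0 f \<longleftrightarrow> continuous_on S f"
| "C_on S (Suc n) f \<longleftrightarrow>
     (\<forall>x\<in>S. f differentiable (at x)) \<and> (\<forall>h. C_on S n (\<lambda>x. frechet_derivative f (at x) h))"

lemma C_fun_iff_C_on: "C_fun n f \<longleftrightarrow> C_on UNIV n f"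
  by (induction n arbitrary: f) auto

lemma C_on_cong:
  assumes "open S" "\<And>x. x \<in> S \<Longrightarrow> f x = g x" "C_on S n f"
  shows "C_on S n g"
  using assms(2,3)
proof (induction n arbitrary: f g)
  case 0
  then show ?case by (metis C_on.simps(1) continuous_on_cong)
next
  case (Suc n)
  have d: "(g has_derivative frechet_derivative f (at x)) (at x)" if "x \<in> S" for x
  proof (rule has_derivative_transform_within_open[OF _ assms(1) that])
    show "(f has_derivative frechet_derivative f (at x)) (at x)"
      using Suc.prems(2) that by (simp add: frechet_derivative_works)
  qed (use Suc.prems(1) in auto)
  have eq: "frechet_derivative f (at x) = frechet_derivative g (at x)" if "x \<in> S" for x
    using frechet_derivative_at[OF d[OF that]] .
  have "C_on S n (\<lambda>x. frechet_derivative g (at x) h)" for h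
    by (rule Suc.IH[of "\<lambda>x. frechet_derivative f (at x) h"]) (use Suc.prems(2) eq in auto)
  then show ?case using d by (auto simp: differentiable_def)
qed

lemma C_on_SucI:
  assumes "open S" "\<And>x. x \<in> S \<Longrightarrow> (f has_derivative f' x) (at x)"
    "\<And>h. C_on S n (\<lambda>x. f' x h)"
  shows "C_on S (Suc n) f"
proof -
  have "C_on S n (\<lambda>x. frechet_derivative f (at x) h)" for h
    by (rule C_on_cong[OF assms(1) _ assms(3)[of h]])
      (simp add: frechet_derivative_at[OF assms(2), symmetric])
  then show ?thesis using assms(2) by (auto simp: differentiable_def)
qed

lemma C_on_has_derivative:
  assumes "C_on S (Suc n) f" "x \<in> S"
  shows "(f has_derivative frechet_derivative f (at x)) (at x)"
  using assms by (simp add: frechet_derivative_works)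

lemma C_on_imp_continuous_on: "C_on S n f \<Longrightarrow> continuous_on S f"
proof (cases n)
  case (Suc m)
  assume "C_on S n f"
  then show ?thesis
    unfolding Suc by (intro differentiable_imp_continuous_on)
      (simp add: differentiable_on_def differentiable_at_withinI)
qed simp

lemma C_on_Suc_imp: "C_on S (Suc n) f \<Longrightarrow> C_on S n f"
proof (induction n arbitrary: f)
  case 0
  then show ?case using C_on_imp_continuous_on[OF 0] by simp
next
  case (Suc n)
  have "C_on S n (\<lambda>x. frechet_derivative f (at x) h)" for h
    by (rule Suc.IH) (use Suc.prems in simp)
  then show ?case using Suc.prems by simp
qed

lemma C_on_subset: "C_on T n f \<Longrightarrow> S \<subseteq> T \<Longrightarrow> C_on S n f"
proof (induction n arbitrary: f)
  case (Suc n)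
  then show ?case by (simp add: subset_iff)
qed (auto intro: continuous_on_subset)

lemma C_on_Un:
  "open S \<Longrightarrow> open T \<Longrightarrow> C_on S n f \<Longrightarrow> C_on T n f \<Longrightarrow> C_on (S \<union> T) n f"
  by (induction n arbitrary: f) (auto intro: continuous_on_open_Un)

lemma C_on_const: "C_on S n (\<lambda>x. c)"
  by (induction n arbitrary: c) auto

lemma C_on_add:
  assumes "open S" "C_on S n f" "C_on S n g"
  shows "C_on S n (\<lambda>x. f x + g x)"
  using assms(2,3)
proof (induction n arbitrary: f g)
  case 0
  then show ?case by (auto intro: continuous_intros)
next
  case (Suc n)
  show ?case
    by (rule C_on_SucI[OF assms(1) has_derivative_add[OF Suc.prems[THEN C_on_has_derivative]]])
      (use Suc in auto)
qed

lemma C_on_mult: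
  assumes "open S" "C_on S n f" "C_on S n g"
  shows "C_on S n (\<lambda>x. f x * g x)"
  using assms(2,3)
proof (induction n arbitrary: f g)
  case 0
  then show ?case by (auto intro: continuous_intros)
next
  case (Suc n)
  note IH = Suc.IH[OF _ C_on_Suc_imp[OF Suc.prems(2)]] Suc.IH[OF C_on_Suc_imp[OF Suc.prems(1)]]
  show ?case
    by (rule C_on_SucI[OF assms(1) has_derivative_mult[OF Suc.prems[THEN C_on_has_derivative]]])
      (use Suc.prems in \<open>auto intro!: C_on_add[OF assms(1)] IH\<close>)
qed

lemma C_on_power: "open S \<Longrightarrow> C_on S n f \<Longrightarrow> C_on S n (\<lambda>x. f x ^ k)"
  by (induction k) (auto intro: C_on_mult C_on_const)

lemma C_on_diff: "open S \<Longrightarrow> C_on S n f \<Longrightarrow> C_on S n g \<Longrightarrow> C_on S n (\<lambda>x. f x - g x)"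
  using C_on_add[of S n f "\<lambda>x. (-1) * g x"] C_on_mult[of S n "\<lambda>_. -1" g] C_on_const[of S n "-1"]
  by simp

lemma C_on_sum:
  assumes "open S" "\<And>i. i \<in> I \<Longrightarrow> C_on S n (f i)"
  shows "C_on S n (\<lambda>x. \<Sum>i\<in>I. f i x)"
  using assms(2) by (induction I rule: infinite_finite_induct)
    (auto intro!: C_on_add[OF assms(1)] C_on_const)

lemma C_on_bounded_linear:
  assumes "open S" "bounded_linear f"
  shows "C_on S n f"
proof (cases n)
  case 0
  then show ?thesis using assms(2) by (simp add: linear_continuous_on)
next
  case (Suc m)
  then show ?thesis
    using assms by (auto intro!: C_on_SucI[of S f "\<lambda>_. f"] C_on_const
        bounded_linear_imp_has_derivative simp del: C_on.simps)
qed

lemma C_on_inner: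
  fixes f g :: "'a::euclidean_space \<Rightarrow> 'b::euclidean_space"
  assumes "open S" "linear f" "linear g"
  shows "C_on S n (\<lambda>x. f x \<bullet> g x)"
proof -
  have "C_on S n (\<lambda>x. f x \<bullet> b)" "C_on S n (\<lambda>x. g x \<bullet> b)" for b
    using assms(2,3)
    by (auto intro!: C_on_bounded_linear[OF assms(1)] bounded_linear_inner_left_comp
        simp: linear_conv_bounded_linear)
  then have "C_on S n (\<lambda>x. \<Sum>b\<in>Basis. (f x \<bullet> b) * (g x \<bullet> b))"
    by (intro C_on_sum[OF assms(1)] C_on_mult[OF assms(1)])
  then show ?thesis by (simp only: euclidean_inner[symmetric])
qed

lemma C_on_compose:
  fixes F :: "real \<Rightarrow> real"
  assumes "open S" "\<And>x. x \<in> S \<Longrightarrow> g x \<in> T" "C_on T n F" "C_on S n g"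
  shows "C_on S n (\<lambda>x. F (g x))"
  using assms(3,4)
proof (induction n arbitrary: F)
  case 0
  then show ?case using continuous_on_compose2[of T F S g] assms(2) by auto
next
  case (Suc n)
  let ?F' = "\<lambda>y. frechet_derivative F (at y) 1"
  show ?case
  proof (rule C_on_SucI[OF assms(1)])
    fix x assume x: "x \<in> S"
    have F: "(F has_derivative frechet_derivative F (at (g x))) (at (g x))"
      by (rule C_on_has_derivative[OF Suc.prems(1) assms(2)[OF x]])
    have g: "(g has_derivative frechet_derivative g (at x)) (at x)"
      by (rule C_on_has_derivative[OF Suc.prems(2) x])
    define c where "c = ?F' (g x)"
    have lin: "frechet_derivative F (at (g x)) = (\<lambda>h. h * c)"
      unfolding c_def by (rule ext)
        (rule linear_cmul[OF has_derivative_linear[OF F], of _ 1, unfolded real_scaleR_def mult_1_right])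
    have "((\<lambda>x. F (g x)) has_derivative (\<lambda>h. frechet_derivative g (at x) h * c)) (at x)"
      using has_derivative_compose[OF g F] unfolding lin .
    then show "((\<lambda>x. F (g x)) has_derivative
        (\<lambda>h. frechet_derivative g (at x) h * ?F' (g x))) (at x)"
      unfolding c_def .
  next
    fix h
    show "C_on S n (\<lambda>x. frechet_derivative g (at x) h * ?F' (g x))"
    proof (rule C_on_mult[OF assms(1)])
      show "C_on S n (\<lambda>x. frechet_derivative g (at x) h)"
        using Suc.prems(2) by simp
      show "C_on S n (\<lambda>x. ?F' (g x))"
        by (rule Suc.IH) (use Suc.prems(1) C_on_Suc_imp[OF Suc.prems(2)] in simp_all)
    qed
  qed
qed

lemma C_on_real_SucI:
  fixes F :: "real \<Rightarrow> real"
  assumes "open T" "\<And>y. y \<in> T \<Longrightarrow> (F has_real_derivative F' y) (at y)" "C_on T n F'"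
  shows "C_on T (Suc n) F"
  by (rule C_on_SucI[OF assms(1) assms(2)[THEN has_field_derivative_imp_has_derivative]])
    (use assms in \<open>auto intro!: C_on_mult C_on_const\<close>)

lemma continuous_on_frechet_derivative_field:
  assumes "C_on S (Suc 0) f" "continuous_on S w"
  shows "continuous_on S (\<lambda>x. frechet_derivative f (at x) (w x))"
proof -
  have "frechet_derivative f (at x) (w x) = (\<Sum>b\<in>Basis. (w x \<bullet> b) * frechet_derivative f (at x) b)"
    if "x \<in> S" for x
  proof -
    have lin: "linear (frechet_derivative f (at x))"
      using C_on_has_derivative[OF assms(1) that] by (rule has_derivative_linear)
    have "frechet_derivative f (at x) (\<Sum>b\<in>Basis. (w x \<bullet> b) *\<^sub>R b)
        = (\<Sum>b\<in>Basis. (w x \<bullet> b) * frechet_derivative f (at x) b)"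
      by (simp only: linear_sum[OF lin] linear_cmul[OF lin] real_scaleR_def)
    then show ?thesis by (simp only: euclidean_representation)
  qed
  moreover have "continuous_on S (\<lambda>x. \<Sum>b\<in>Basis. (w x \<bullet> b) * frechet_derivative f (at x) b)"
    using assms by (intro continuous_intros) auto
  ultimately show ?thesis by simp
qed

text \<open>
  This turns products with the singular weights into globally smooth functions: the complement of
  the support and the domain of the weight cover the space.
\<close>

lemma C_on_extend_by_zero:
  assumes "open U" "closed C" "C \<subseteq> U" "C_on U n f" "\<And>x. x \<notin> C \<Longrightarrow> f x = 0"
  shows "C_on UNIV n f"
proof -
  have "C_on (- C) n f"
    by (rule C_on_cong[OF _ _ C_on_const[of _ _ 0]]) (use assms in auto)
  then have "C_on (U \<union> - C) n f"
    using assms(1,2,4) by (intro C_on_Un) auto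
  moreover have "U \<union> - C = UNIV" using assms(3) by auto
  ultimately show ?thesis by simp
qed

lemma C1_has_derivative:
  "C_on UNIV 1 f \<Longrightarrow> (f has_derivative frechet_derivative f (at x)) (at x)"
  by (rule C_on_has_derivative[of UNIV 0]) simp_all

lemma C1_continuous_on: "C_on UNIV 1 f \<Longrightarrow> continuous_on S f"
  using continuous_on_subset[OF C_on_imp_continuous_on] by blast

lemma C_on_exp: "C_on UNIV n (exp :: real \<Rightarrow> real)"
proof (induction n)
  case (Suc n)
  show ?case by (rule C_on_real_SucI[OF _ _ Suc]) (auto intro: DERIV_exp)
qed (auto intro: continuous_intros)

lemma C_on_inverse: "C_on {0<..} n (inverse :: real \<Rightarrow> real)"
proof (induction n)
  case (Suc n)
  have "C_on {0<..} n (\<lambda>y::real. -1 * (inverse y * inverse y))"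
    by (intro C_on_mult Suc C_on_const) auto
  then show ?case
    by (rule C_on_real_SucI[rotated 2]) (auto intro!: derivative_eq_intros simp: field_simps)
qed (auto intro!: continuous_intros)

lemma C_on_ln: "C_on {0<..} n (ln :: real \<Rightarrow> real)"
proof (cases n)
  case (Suc m)
  show ?thesis unfolding Suc
    by (rule C_on_real_SucI[OF _ _ C_on_inverse]) (auto intro!: DERIV_ln)
qed (auto intro!: continuous_intros)

lemma C_on_powr: "C_on {0<..} n (\<lambda>y::real. y powr a)"
proof -
  have "C_on {0<..} n (\<lambda>y::real. exp (a * ln y))"
    by (rule C_on_compose[OF _ _ C_on_exp]) (auto intro!: C_on_mult C_on_const C_on_ln)
  then show ?thesis by (rule C_on_cong[rotated 2]) (auto simp: powr_def)
qed

section \<open>A smooth step\<close>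

text \<open>
  The family \<open>p(1/t) e\<^sup>-\<^sup>1\<^sup>/\<^sup>t\<close> for polynomials \<open>p\<close>, extended by zero, is closed under differentiation;
  this makes the smoothness of \<open>e\<^sup>-\<^sup>1\<^sup>/\<^sup>t\<close> at the origin a plain induction.
\<close>

definition flat :: "real poly \<Rightarrow> real \<Rightarrow> real" where
  "flat p t = (if t > 0 then poly p (inverse t) * exp (- inverse t) else 0)"

lemma poly_times_exp_tendsto_0: "((\<lambda>s::real. poly p s * exp (- s)) \<longlongrightarrow> 0) at_top"
proof -
  have "((\<lambda>s. \<Sum>i\<le>degree p. coeff p i * (s ^ i / exp s)) \<longlongrightarrow> (\<Sum>i\<le>degree p. coeff p i * 0)) at_top"
    by (rule tendsto_sum, rule tendsto_mult[OF tendsto_const tendsto_power_div_exp_0])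
  moreover have "(\<Sum>i\<le>degree p. coeff p i * (s ^ i / exp s)) = poly p s * exp (- s)" for s
    by (simp add: poly_altdef sum_distrib_right exp_minus divide_inverse mult.assoc)
  ultimately show ?thesis by simp
qed

lemma flat_tendsto_0: "(flat p \<longlongrightarrow> 0) (at 0)"
proof -
  have "((\<lambda>t. poly p (inverse t) * exp (- inverse t)) \<longlongrightarrow> 0) (at_right 0)"
    using filterlim_compose[OF poly_times_exp_tendsto_0 filterlim_inverse_at_top_right] .
  then have "(flat p \<longlongrightarrow> 0) (at_right 0)"
    by (rule Lim_transform_eventually) (auto simp: flat_def eventually_at_filter)
  moreover have "(flat p \<longlongrightarrow> 0) (at_left 0)"
    by (rule Lim_transform_eventually[OF tendsto_const]) (auto simp: flat_def eventually_at_filter)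
  ultimately show ?thesis by (simp add: filterlim_split_at)
qed

lemma DERIV_flat: "(flat p has_real_derivative flat ([:0,0,1:] * (p - pderiv p)) t) (at t)"
proof -
  let ?q = "[:0,0,1:] * (p - pderiv p)"
  consider "t > 0" | "t < 0" | "t = 0" by linarith
  then show ?thesis
  proof cases
    case 1
    have "((\<lambda>t. poly p (inverse t) * exp (- inverse t)) has_real_derivative flat ?q t) (at t)"
      using 1 by (auto intro!: derivative_eq_intros simp: flat_def)
        (simp add: field_simps power2_eq_square)
    then show ?thesis
      by (rule DERIV_cong_ev[THEN iffD1, rotated -1, OF _ refl _ refl])
        (use 1 in \<open>auto simp: flat_def intro!: eventually_nhds_in_open[of "{0<..}" t, THEN eventually_mono]\<close>)
  next
    case 2
    have "((\<lambda>t. 0) has_real_derivative flat ?q t) (at t)"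
      using 2 by (simp add: flat_def)
    then show ?thesis
      by (rule DERIV_cong_ev[THEN iffD1, rotated -1, OF _ refl _ refl])
        (use 2 in \<open>auto simp: flat_def intro!: eventually_nhds_in_open[of "{..<0}" t, THEN eventually_mono]\<close>)
  next
    case 3
    \<comment> \<open>For \<open>h > 0\<close> the difference quotient is \<open>(1/h) p(1/h) e\<^sup>-\<^sup>1\<^sup>/\<^sup>h\<close>, again a member of the family.\<close>
    have "((\<lambda>h. (flat p h - flat p 0) / (h - 0)) \<longlongrightarrow> 0) (at 0)"
      by (rule Lim_transform_eventually[OF flat_tendsto_0[of "[:0,1:] * p"]])
        (auto simp: flat_def eventually_at_filter field_simps)
    then show ?thesis using 3 by (simp add: has_field_derivative_iff flat_def)
  qed
qed

lemma C_on_flat: "C_on UNIV n (flat p)"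
proof (induction n arbitrary: p)
  case 0
  show ?case by (auto intro!: DERIV_isCont[OF DERIV_flat] simp: continuous_on_eq_continuous_at)
next
  case (Suc n)
  show ?case by (rule C_on_real_SucI[OF _ DERIV_flat Suc]) auto
qed

text \<open>
  The step is \<open>f(t) / (f(t) + f(1 - t))\<close> with \<open>f(t) = e\<^sup>-\<^sup>1\<^sup>/\<^sup>t\<close> for \<open>t > 0\<close>. The bound on its derivative
  \<open>b\<close> is what later controls the flanks of the extremal profiles.
\<close>

lemma smooth_step_exists:
  obtains B b :: "real \<Rightarrow> real" and M :: real
  where "\<And>n. C_on UNIV n B" "\<And>t. (B has_real_derivative b t) (at t)" "continuous_on UNIV b"
    "\<And>t. 0 \<le> b t" "\<And>t. b t \<le> M" "\<And>t. t \<notin> {0<..<1} \<Longrightarrow> b t = 0"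
    "\<And>t. t \<le> 0 \<Longrightarrow> B t = 0" "\<And>t. 1 \<le> t \<Longrightarrow> B t = 1"
proof -
  define f where "f = flat 1"
  define f' where "f' = flat [:0,0,1:]"
  have f: "(f has_real_derivative f' t) (at t)" for t
    using DERIV_flat[of 1 t] by (simp add: f_def f'_def pderiv_1)
  have nn: "0 \<le> f t" "0 \<le> f' t" for t by (auto simp: f_def f'_def flat_def)
  have pos: "t > 0 \<Longrightarrow> f t > 0" for t by (simp add: f_def flat_def)
  have den: "f t + f (1 - t) > 0" for t
    using nn[of t] nn[of "1-t"] pos[of t] pos[of "1-t"] by (cases "t > 0") auto
  define B where "B t = f t * inverse (f t + f (1 - t))" for t
  define b where "b t = (f' t * f (1 - t) + f t * f' (1 - t)) / (f t + f (1 - t))\<^sup>2" for t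
  have lin: "C_on UNIV n (\<lambda>t::real. 1 - t)" for n
    by (intro C_on_diff C_on_const C_on_bounded_linear bounded_linear_ident) auto
  have smooth_f: "C_on UNIV n f" for n by (simp add: f_def C_on_flat)
  have smooth: "C_on UNIV n B" for n
    unfolding B_def
    by (intro C_on_mult smooth_f C_on_compose[OF _ _ C_on_inverse] C_on_add
        C_on_compose[OF _ _ smooth_f lin]) (use den in auto)
  have deriv: "(B has_real_derivative b t) (at t)" for t
  proof -
    have "((\<lambda>t. f (1 - t)) has_real_derivative f' (1 - t) * (-1)) (at t)"
      by (rule DERIV_chain2[OF f]) (auto intro!: derivative_eq_intros)
    from DERIV_divide[OF f DERIV_add[OF f this]]
    have "((\<lambda>t. f t / (f t + f (1 - t))) has_real_derivative b t) (at t)"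
      by (rule DERIV_cong) (use den[of t] in \<open>simp_all add: b_def power2_eq_square algebra_simps\<close>)
    then show ?thesis by (simp add: B_def[abs_def] divide_inverse)
  qed
  have cont: "continuous_on UNIV b"
  proof -
    have "continuous_on UNIV f" "continuous_on UNIV f'"
      unfolding f_def f'_def by (rule C_on_imp_continuous_on[OF C_on_flat[of 0]])+
    then have "continuous_on UNIV (\<lambda>t. f (1 - t))" "continuous_on UNIV (\<lambda>t. f' (1 - t))"
      by (auto intro!: continuous_on_compose2[of UNIV _ UNIV "\<lambda>t. 1 - t"] continuous_intros)
    with \<open>continuous_on UNIV f\<close> \<open>continuous_on UNIV f'\<close> show ?thesis
      unfolding b_def using den by (intro continuous_intros) (auto simp: less_imp_neq[symmetric])
  qed
  have out: "b t = 0" if "t \<notin> {0<..<1}" for t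
    using that by (auto simp: b_def f_def f'_def flat_def)
  have "compact (b ` {0..1})"
    by (intro compact_continuous_image continuous_on_subset[OF cont]) auto
  then obtain M where M: "\<And>y. y \<in> b ` {0..1} \<Longrightarrow> norm y \<le> M"
    using bounded_iff compact_imp_bounded by metis
  have "b t \<le> M" for t
  proof (cases "t \<in> {0..1}")
    case True
    then show ?thesis using M[of "b t"] by auto
  next
    case False
    have "0 \<le> M" using M[of "b 0"] by (auto intro: order_trans[OF norm_ge_zero])
    moreover have "b t = 0" using False by (intro out) auto
    ultimately show ?thesis by simp
  qed
  moreover have "0 \<le> b t" for t using nn by (simp add: b_def)
  moreover have "B t = 0" if "t \<le> 0" for t using that by (simp add: B_def f_def flat_def)
  moreover have "B t = 1" if "1 \<le> t" for t
    using that pos[of t] by (simp add: B_def f_def flat_def)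
  ultimately show ?thesis using that smooth deriv cont out by blast
qed

section \<open>Integration by parts along divergence-free affine fields\<close>

lemma has_real_derivative_along_curve:
  assumes "(f has_derivative f') (at (c s))" "(c has_vector_derivative w) (at s)"
  shows "((\<lambda>s. f (c s)) has_real_derivative f' w) (at s)"
proof -
  have "((\<lambda>s. f (c s)) has_derivative (\<lambda>h. f' (h *\<^sub>R w))) (at s)"
    using has_derivative_compose[OF assms(2)[unfolded has_vector_derivative_def] assms(1)] .
  moreover have "f' (h *\<^sub>R w) = f' w * h" for h
    using linear_cmul[OF has_derivative_linear[OF assms(1)], of h w] by simp
  ultimately show ?thesis by (simp add: has_field_derivative_def)
qed

lemma has_derivative_zero_outside:
  fixes f :: "'a::euclidean_space \<Rightarrow> real"
  assumes "(f has_derivative f') (at x)" "closed C" "\<And>x. x \<notin> C \<Longrightarrow> f x = 0" "x \<notin> C"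
  shows "f' h = 0"
proof -
  have "((\<lambda>x. 0) has_derivative f') (at x)"
    by (rule has_derivative_transform_within_open[OF assms(1), of "- C"])
      (use assms in \<open>auto simp: open_Compl\<close>)
  then have "f' = (\<lambda>h. 0)" by (rule has_derivative_unique) simp
  then show ?thesis by simp
qed

lemma integrable_compact_support:
  fixes u :: "'a::euclidean_space \<Rightarrow> real"
  assumes "compact C" "continuous_on C u" "\<And>x. x \<notin> C \<Longrightarrow> u x = 0"
  shows "integrable lborel u"
proof -
  have "integrable lborel (\<lambda>x. indicator C x *\<^sub>R u x)"
    by (rule borel_integrable_compact[OF assms(1,2)])
  moreover have "(\<lambda>x. indicator C x *\<^sub>R u x) = u"
    using assms(3) by (intro ext) (simp add: indicator_def, blast)
  ultimately show ?thesis by (simp only:)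
qed

text \<open>
  Difference quotients of \<open>f\<close> have integral zero by translation invariance of Lebesgue measure, and
  they converge to the derivative under a bound that is constant on a ball containing all the
  supports.
\<close>

lemma integral_directional_derivative_eq_0:
  fixes f :: "'a::euclidean_space \<Rightarrow> real"
  assumes d: "\<And>x. (f has_derivative f' x) (at x)"
    and cont: "continuous_on UNIV (\<lambda>x. f' x b)"
    and C: "compact C" "\<And>x. x \<notin> C \<Longrightarrow> f x = 0"
  shows "integrable lborel (\<lambda>x. f' x b)" "integral\<^sup>L lborel (\<lambda>x. f' x b) = 0"
proof -
  have out: "f' x b = 0" if "x \<notin> C" for x
    using has_derivative_zero_outside[OF d compact_imp_closed[OF C(1)] C(2) that] by simp
  show "integrable lborel (\<lambda>x. f' x b)"
    by (rule integrable_compact_support[OF C(1) continuous_on_subset[OF cont]]) (auto simp: out)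
  have f_cont: "continuous_on S f" for S
    by (intro continuous_at_imp_continuous_on ballI has_derivative_continuous[OF d])
  have f_int: "integrable lborel f"
    by (rule integrable_compact_support[OF C(1) f_cont C(2)])
  obtain R where R: "\<And>x. x \<in> C \<Longrightarrow> norm x \<le> R"
    using compact_imp_bounded[OF C(1)] bounded_iff by metis
  have "bounded ((\<lambda>x. f' x b) ` C)"
    by (intro compact_imp_bounded compact_continuous_image C continuous_on_subset[OF cont]) auto
  then obtain M0 where M0: "\<And>x. x \<in> C \<Longrightarrow> \<bar>f' x b\<bar> \<le> M0"
    unfolding bounded_iff by auto
  \<comment> \<open>For empty \<open>C\<close> the bound \<open>M0\<close> could be negative.\<close>
  define M where "M = max M0 0"
  have M: "\<bar>f' x b\<bar> \<le> M" for x
    using M0[of x] out[of x] by (cases "x \<in> C") (auto simp: M_def)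
  define t where "t n = inverse (real (Suc n))" for n
  have t: "0 < t n" "t n \<le> 1" for n by (auto simp: t_def field_simps)
  have t0: "filterlim t (at 0) sequentially"
    using LIMSEQ_inverse_real_of_nat t(1) unfolding t_def[abs_def]
    by (auto simp: filterlim_at)
  have along: "((\<lambda>s. f (x + s *\<^sub>R b)) has_real_derivative f' (x + s *\<^sub>R b) b) (at s)" for x s
    by (rule has_real_derivative_along_curve[OF d]) (auto intro!: derivative_eq_intros)
  define u where "u n x = (f (x + t n *\<^sub>R b) - f x) / t n" for n x
  have lim: "(\<lambda>n. u n x) \<longlonglongrightarrow> f' x b" for x
  proof -
    have "((\<lambda>h. (f (x + h *\<^sub>R b) - f (x + 0 *\<^sub>R b)) / (h - 0)) \<longlongrightarrow> f' (x + 0 *\<^sub>R b) b) (at 0)"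
      using along[of x 0] by (simp only: has_field_derivative_iff)
    from filterlim_compose[OF this t0] show ?thesis by (simp add: u_def)
  qed
  have bound: "norm (u n x) \<le> M * indicator (cball 0 (R + norm b)) x" for n x
  proof -
    obtain z where z: "0 < z" "z < t n" "f (x + t n *\<^sub>R b) - f (x + 0 *\<^sub>R b) = (t n - 0) * f' (x + z *\<^sub>R b) b"
      using MVT2[OF t(1) along] by blast
    then have u: "u n x = f' (x + z *\<^sub>R b) b" using t(1)[of n] by (simp add: u_def)
    show ?thesis
    proof (cases "x \<in> cball 0 (R + norm b)")
      case True
      then show ?thesis using M[of "x + z *\<^sub>R b"] by (simp add: u)
    next
      case False
      have "norm (z *\<^sub>R b) \<le> 1 * norm b"
        unfolding norm_scaleR using z t(2)[of n] by (intro mult_right_mono) auto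
      with False have "R < norm (x + z *\<^sub>R b)"
        using norm_triangle_ineq4[of "x + z *\<^sub>R b" "z *\<^sub>R b"] by simp
      then have "x + z *\<^sub>R b \<notin> C" using R by force
      then show ?thesis using False by (simp add: u out)
    qed
  qed
  have shift: "integrable lborel (\<lambda>x. f (x + c))" "integral\<^sup>L lborel (\<lambda>x. f (x + c)) = integral\<^sup>L lborel f" for c
  proof -
    have [measurable]: "f \<in> borel_measurable borel"
      by (rule borel_measurable_continuous_onI[OF f_cont])
    have D: "distr lborel borel (\<lambda>x. x + c) = lborel"
      unfolding add.commute[of _ c] by (rule lborel_distr_plus)
    show "integrable lborel (\<lambda>x. f (x + c))"
      using f_int integrable_distr_eq[of "\<lambda>x. x + c" lborel borel f] by (simp add: D)
    show "integral\<^sup>L lborel (\<lambda>x. f (x + c)) = integral\<^sup>L lborel f"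
      using integral_distr[of "\<lambda>x. x + c" lborel borel f] by (simp add: D)
  qed
  have u_int: "integral\<^sup>L lborel (u n) = 0" for n
    unfolding u_def using shift f_int by simp
  have "(\<lambda>n. integral\<^sup>L lborel (u n)) \<longlonglongrightarrow> integral\<^sup>L lborel (\<lambda>x. f' x b)"
  proof (rule integral_dominated_convergence)
    show "integrable lborel (\<lambda>x. M * indicator (cball 0 (R + norm b)) x)"
      by (intro integrable_mult_right integrable_real_indicator) (auto simp: emeasure_bounded_finite[OF bounded_cball, unfolded infinity_ennreal_def])
    show "(\<lambda>x. f' x b) \<in> borel_measurable lborel"
      using borel_measurable_continuous_onI[OF cont] by simp
    show "u n \<in> borel_measurable lborel" for n
      unfolding u_def by (intro borel_measurable_divide borel_measurable_diff
          borel_measurable_integrable shift f_int borel_measurable_const)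
  qed (use lim bound in auto)
  then show "integral\<^sup>L lborel (\<lambda>x. f' x b) = 0"
    by (simp add: u_int LIMSEQ_const_iff)
qed

text \<open>
  Expanding \<open>A b\<close> in an orthonormal basis \<open>C\<close> of \<open>V\<close> and exchanging the sums turns the trace into
  \<open>\<Sum>\<^sub>c A c \<bullet> c\<close>, where \<open>c\<close> runs over vectors that \<open>A\<close> kills.
\<close>

lemma trace_eq_0:
  fixes A :: "'a::euclidean_space \<Rightarrow> 'a"
  assumes "linear A" "subspace V" "range A \<subseteq> V" "\<And>v. v \<in> V \<Longrightarrow> A v = 0"
  shows "(\<Sum>b\<in>Basis. A b \<bullet> b) = 0"
proof -
  obtain C where C: "C \<subseteq> V" "pairwise orthogonal C" "\<And>x. x \<in> C \<Longrightarrow> norm x = 1"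
      "independent C" "span C = V"
    using orthonormal_basis_subspace[OF assms(2)] by metis
  have fC: "finite C" using C(4) by (rule independent_imp_finite)
  have "A b = (\<Sum>c\<in>C. (A b \<bullet> c) *\<^sub>R c)" for b
    using orthonormal_basis_expand[of C "A b"] C fC assms(3) by (simp add: subset_iff)
  then have "(\<Sum>b\<in>Basis. A b \<bullet> b) = (\<Sum>b\<in>Basis. (\<Sum>c\<in>C. (A b \<bullet> c) *\<^sub>R c) \<bullet> b)"
    by metis
  also have "\<dots> = (\<Sum>c\<in>C. \<Sum>b\<in>Basis. (c \<bullet> b) * (A b \<bullet> c))"
    by (subst sum.swap) (simp add: inner_sum_left mult.commute)
  also have "\<dots> = (\<Sum>c\<in>C. A (\<Sum>b\<in>Basis. (c \<bullet> b) *\<^sub>R b) \<bullet> c)"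
    by (simp add: linear_sum[OF assms(1)] linear_cmul[OF assms(1)] inner_sum_left)
  also have "\<dots> = 0"
    using C(1) assms(4) by (intro sum.neutral) (auto simp: euclidean_representation)
  finally show ?thesis .
qed

text \<open>
  Componentwise, \<open>\<langle>A x, b\<rangle> \<partial>\<^sub>b f = \<partial>\<^sub>b (\<langle>A x, b\<rangle> f) - \<langle>A b, b\<rangle> f\<close>. The first terms integrate to zero and
  the second ones add up to the trace.
\<close>

lemma integral_affine_field_eq_0:
  fixes f :: "'a::euclidean_space \<Rightarrow> real" and A :: "'a \<Rightarrow> 'a"
  assumes f: "C_on UNIV 1 f" and C: "compact C" "\<And>x. x \<notin> C \<Longrightarrow> f x = 0"
    and A: "linear A" "(\<Sum>b\<in>Basis. A b \<bullet> b) = 0"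
  shows "integrable lborel (\<lambda>x. frechet_derivative f (at x) (a + A x))"
    "integral\<^sup>L lborel (\<lambda>x. frechet_derivative f (at x) (a + A x)) = 0"
proof -
  let ?D = "\<lambda>x. frechet_derivative f (at x)"
  note d = C1_has_derivative[OF f]
  have cont: "continuous_on UNIV (\<lambda>x. ?D x h)" for h
    using f by simp
  have bA: "bounded_linear A" using A(1) by (simp add: linear_conv_bounded_linear)
  define g where "g b x h = (A h \<bullet> b) * f x + (A x \<bullet> b) * ?D x h" for b x h
  have g: "((\<lambda>x. (A x \<bullet> b) * f x) has_derivative g b x) (at x)" for b x
    unfolding g_def
    by (rule has_derivative_eq_rhs[OF has_derivative_mult[OF
        has_derivative_inner_left[OF bounded_linear_imp_has_derivative[OF bA]] d]]) (auto simp: algebra_simps)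
  have g_cont: "continuous_on UNIV (\<lambda>x. g b x h)" for b h
    unfolding g_def
    by (intro continuous_intros C1_continuous_on[OF f] cont linear_continuous_on[OF bA])
  have g_int: "integrable lborel (\<lambda>x. g b x h)" "integral\<^sup>L lborel (\<lambda>x. g b x h) = 0" for b h
    using integral_directional_derivative_eq_0[OF g g_cont C(1)] C(2) by auto
  have a_int: "integrable lborel (\<lambda>x. ?D x a)" "integral\<^sup>L lborel (\<lambda>x. ?D x a) = 0"
    using integral_directional_derivative_eq_0[OF d cont C] by auto
  have eq: "?D x (a + A x) = ?D x a + (\<Sum>b\<in>Basis. g b x b)" for x
  proof -
    have lin: "linear (?D x)" using d by (rule has_derivative_linear)
    have "?D x (A x) = ?D x (\<Sum>b\<in>Basis. (A x \<bullet> b) *\<^sub>R b)"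
      by (simp add: euclidean_representation)
    also have "\<dots> = (\<Sum>b\<in>Basis. (A x \<bullet> b) * ?D x b)"
      by (simp only: linear_sum[OF lin] linear_cmul[OF lin] real_scaleR_def)
    also have "\<dots> = (\<Sum>b\<in>Basis. g b x b)"
      using A(2) by (simp add: g_def sum.distrib flip: sum_distrib_right)
    finally show ?thesis by (simp only: linear_add[OF lin])
  qed
  show "integrable lborel (\<lambda>x. ?D x (a + A x))"
    unfolding eq by (intro Bochner_Integration.integrable_add Bochner_Integration.integrable_sum a_int g_int)
  show "integral\<^sup>L lborel (\<lambda>x. ?D x (a + A x)) = 0"
    unfolding eq using a_int g_int
    by (simp add: Bochner_Integration.integral_add Bochner_Integration.integral_sum Bochner_Integration.integrable_sum)
qed

section \<open>Geometry of an H-type group\<close>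

locale H_type_frame = H_type_algebra br V1 V2
  for br :: "'g::euclidean_space \<Rightarrow> 'g \<Rightarrow> 'g" and V1 V2 :: "'g set" +
  fixes E :: "'g set"
  assumes frame: "orthonormal_basis_of E V1"
begin

abbreviation hor :: "'g \<Rightarrow> 'g" where "hor \<equiv> v_part V1 V2"
abbreviation vert :: "'g \<Rightarrow> 'g" where "vert \<equiv> z_part V1 V2"

lemma hor_in: "hor x \<in> V1" and diff_hor_in: "x - hor x \<in> V2"
  using theI'[OF ex1_v_part[of x]] by (simp_all add: v_part_def)

lemma hor_eqI: "v \<in> V1 \<Longrightarrow> x - v \<in> V2 \<Longrightarrow> hor x = v"
  using ex1_v_part[of x] hor_in[of x] diff_hor_in[of x] by blast

lemma vert_in: "vert x \<in> V2" and diff_vert_in: "x - vert x \<in> V1"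
  using theI'[OF ex1_z_part[of x]] by (simp_all add: z_part_def)

lemma vert_eq: "vert x = x - hor x"
  using ex1_z_part[of x] hor_in[of x] diff_hor_in[of x] vert_in[of x] diff_vert_in[of x]
  by (metis add_diff_cancel_left' diff_add_cancel)

lemma linear_hor: "linear hor"
proof (rule linearI)
  fix x y :: 'g and c :: real
  have "x + y - (hor x + hor y) = (x - hor x) + (y - hor y)" by simp
  then show "hor (x + y) = hor x + hor y"
    by (intro hor_eqI subspace_add[OF subspace_V1] hor_in)
      (simp only: subspace_add[OF subspace_V2] diff_hor_in)
  show "hor (c *\<^sub>R x) = c *\<^sub>R hor x"
    by (intro hor_eqI subspace_scale[OF subspace_V1] hor_in)
      (simp only: scaleR_diff_right[symmetric] subspace_scale[OF subspace_V2] diff_hor_in)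
qed

lemma linear_vert: "linear vert"
  unfolding vert_eq[abs_def] by (intro linear_compose_sub linear_hor linear_ident)

lemma hor_V1: "v \<in> V1 \<Longrightarrow> hor v = v" and vert_V1: "v \<in> V1 \<Longrightarrow> vert v = 0"
  using hor_eqI[of v v] subspace_0[OF subspace_V2] by (simp_all add: vert_eq)

lemma hor_V2: "w \<in> V2 \<Longrightarrow> hor w = 0" and vert_V2: "w \<in> V2 \<Longrightarrow> vert w = w"
  using hor_eqI[of 0 w] subspace_0[OF subspace_V1] by (simp_all add: vert_eq)

lemma linear_br_left: "linear (\<lambda>x. br x y)" and linear_br_right: "linear (br x)"
  using bilinear_br by (auto simp: bilinear_def)

lemma br_anti: "br y x = - br x y"
proof -
  have "br (x + y) (x + y) = br x x + br x y + (br y x + br y y)"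
    by (simp only: linear_add[OF linear_br_left] linear_add[OF linear_br_right] add_ac)
  then have "br x y + br y x = 0" by (simp add: br_self)
  then show ?thesis by (simp add: eq_neg_iff_add_eq_0 add.commute)
qed

lemma br_in: "u \<in> V1 \<Longrightarrow> u' \<in> V1 \<Longrightarrow> br u u' \<in> V2"
  unfolding br_V1_V1[symmetric] by (rule span_base) blast

lemma br_hor: "e \<in> V1 \<Longrightarrow> br x e = br (hor x) e"
proof -
  assume e: "e \<in> V1"
  have "br (vert x) e = 0"
    using br_anti[of e "vert x"] br_V1_V2[OF e vert_in[of x]] by simp
  moreover have "br (hor x + vert x) e = br (hor x) e + br (vert x) e"
    by (rule linear_add[OF linear_br_left])
  ultimately show ?thesis by (simp add: vert_eq)
qed

definition X :: "'g \<Rightarrow> 'g \<Rightarrow> 'g" where "X e x = e + (1/2) *\<^sub>R br x e"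

lemma hor_X: "e \<in> V1 \<Longrightarrow> hor (X e x) = e"
  by (simp add: X_def br_hor[of e x] linear_add[OF linear_hor] linear_cmul[OF linear_hor]
      hor_V1 hor_V2 br_in hor_in)

lemma vert_X: "e \<in> V1 \<Longrightarrow> vert (X e x) = (1/2) *\<^sub>R br (hor x) e"
  by (simp add: X_def br_hor[of e x] linear_add[OF linear_vert] linear_cmul[OF linear_vert]
      vert_V1 vert_V2 br_in hor_in)

text \<open>
  The map \<open>[\<cdot>, e]\<close> sends everything into the second layer and annihilates that layer; this is why
  \<open>X\<^sub>e\<close> has divergence zero.
\<close>

lemma trace_br:
  assumes "e \<in> V1"
  shows "(\<Sum>b\<in>Basis. ((1/2) *\<^sub>R br b e) \<bullet> b) = 0"
proof (rule trace_eq_0)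
  show "linear (\<lambda>b. (1/2) *\<^sub>R br b e)"
    by (intro linear_compose_scale_right linear_br_left)
  show "range (\<lambda>b. (1/2) *\<^sub>R br b e) \<subseteq> V2"
  proof
    fix y assume "y \<in> range (\<lambda>b. (1/2) *\<^sub>R br b e)"
    then obtain b where "y = (1/2) *\<^sub>R br (hor b) e"
      using br_hor[OF assms] by auto
    then show "y \<in> V2"
      by (simp only: subspace_scale[OF subspace_V2] br_in hor_in assms)
  qed
  show "(1/2) *\<^sub>R br v e = 0" if "v \<in> V2" for v
    using br_anti[of e v] br_V1_V2[OF assms that] by simp
qed (rule subspace_V2)

lemma left_inv_field_eq:
  assumes "(f has_derivative f') (at x)"
  shows "left_inv_field br e f x = f' (X e x)"
proof -
  have "gmult br x (t *\<^sub>R e) = x + t *\<^sub>R X e x" for t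
    by (simp add: gmult_def X_def linear_cmul[OF linear_br_right] scaleR_add_right)
  moreover have "((\<lambda>t. f (x + t *\<^sub>R X e x)) has_real_derivative f' (X e x)) (at 0)"
    by (rule has_real_derivative_along_curve) (use assms in \<open>auto intro!: derivative_eq_intros\<close>)
  ultimately show ?thesis
    unfolding left_inv_field_def by (simp add: DERIV_imp_deriv)
qed

abbreviation J :: "'g \<Rightarrow> 'g \<Rightarrow> 'g" where "J \<equiv> J_map br V1"

lemma J_in: "J z u \<in> V1" and J_inner: "v \<in> V1 \<Longrightarrow> J z u \<bullet> v = z \<bullet> br u v"
  using theI'[OF ex1_J_map[of z u]] by (simp_all add: J_map_def)

lemma J_orthogonal: "u \<in> V1 \<Longrightarrow> J z u \<bullet> u = 0"
  by (simp add: J_inner br_self)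

text \<open>
  Skew-symmetry of \<open>J\<^sub>z\<close> together with \<open>J\<^sub>z\<^sup>2 = -|z|\<^sup>2\<close>.
\<close>

lemma J_norm:
  assumes "z \<in> V2" "u \<in> V1"
  shows "(norm (J z u))\<^sup>2 = (norm z)\<^sup>2 * (norm u)\<^sup>2"
proof -
  have "J z u \<bullet> J z u = - (z \<bullet> br (J z u) u)"
    using J_inner[OF J_in[of z u], of z u] br_anti[of "J z u" u] by simp
  also have "\<dots> = - (J z (J z u) \<bullet> u)"
    using J_inner[OF assms(2), of z "J z u"] by simp
  finally show ?thesis by (simp add: J_square[OF assms] power2_norm_eq_inner)
qed

lemma frame_in: "e \<in> E \<Longrightarrow> e \<in> V1"
  using frame unfolding orthonormal_basis_of_def by (metis span_base)

lemma frame_norm: "e \<in> E \<Longrightarrow> norm e = 1"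
  using frame by (simp add: orthonormal_basis_of_def)

lemma independent_frame: "independent E"
  using frame frame_norm[of 0] by (intro pairwise_orthogonal_independent)
    (auto simp: orthonormal_basis_of_def)

lemma finite_frame: "finite E"
  using independent_frame by (rule independent_imp_finite)

lemma card_frame: "card E = dim V1"
  using frame dim_eq_card_independent[OF independent_frame]
  by (metis dim_span orthonormal_basis_of_def)

lemma parseval:
  assumes "finite B" "pairwise orthogonal B" "\<And>b. b \<in> B \<Longrightarrow> norm b = 1" "u \<in> span B"
  shows "(\<Sum>b\<in>B. (u \<bullet> b)\<^sup>2) = (norm u)\<^sup>2"
proof -
  have "(norm u)\<^sup>2 = u \<bullet> (\<Sum>b\<in>B. (u \<bullet> b) *\<^sub>R b)"
    using orthonormal_basis_expand[OF assms(2,3,4,1)] by (simp add: power2_norm_eq_inner)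
  then show ?thesis by (simp add: inner_sum_right power2_eq_square)
qed

lemma parseval_frame: "u \<in> V1 \<Longrightarrow> (\<Sum>e\<in>E. (u \<bullet> e)\<^sup>2) = (norm u)\<^sup>2"
  using frame by (intro parseval finite_frame) (auto simp: orthonormal_basis_of_def)

text \<open>
  With an orthonormal basis \<open>F\<close> of the second layer, the left-hand side is the double sum of
  \<open>\<langle>J\<^sub>f u, e\<rangle>\<^sup>2\<close>. Each \<open>J\<^sub>f\<close> is an isometry, so summing over \<open>e\<close> first gives \<open>|u|\<^sup>2\<close> for every \<open>f\<close>.
\<close>

lemma sum_norm_br:
  assumes "u \<in> V1"
  shows "(\<Sum>e\<in>E. (norm (br u e))\<^sup>2) = real (dim V2) * (norm u)\<^sup>2"
proof -
  obtain F where F: "F \<subseteq> V2" "pairwise orthogonal F" "\<And>x. x \<in> F \<Longrightarrow> norm x = 1"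
      "independent F" "card F = dim V2" "span F = V2"
    using orthonormal_basis_subspace[OF subspace_V2] by metis
  have fF: "finite F" using F(4) by (rule independent_imp_finite)
  have "(\<Sum>e\<in>E. (norm (br u e))\<^sup>2) = (\<Sum>e\<in>E. \<Sum>f\<in>F. (br u e \<bullet> f)\<^sup>2)"
  proof (rule sum.cong[OF refl])
    fix e assume "e \<in> E"
    then have "br u e \<in> span F" using br_in[OF assms frame_in] F(6) by simp
    then show "(norm (br u e))\<^sup>2 = (\<Sum>f\<in>F. (br u e \<bullet> f)\<^sup>2)"
      using parseval[OF fF F(2,3)] by simp
  qed
  also have "\<dots> = (\<Sum>f\<in>F. \<Sum>e\<in>E. (J f u \<bullet> e)\<^sup>2)"
    by (subst sum.swap) (intro sum.cong refl, simp add: J_inner frame_in inner_commute[of "br _ _"])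
  also have "\<dots> = (\<Sum>f\<in>F. (norm u)\<^sup>2)"
  proof (rule sum.cong[OF refl])
    fix f assume "f \<in> F"
    then have "f \<in> V2" "norm f = 1" using F(1,3) by auto
    then show "(\<Sum>e\<in>E. (J f u \<bullet> e)\<^sup>2) = (norm u)\<^sup>2"
      using J_norm[of f u] assms by (simp add: parseval_frame J_in)
  qed
  finally show ?thesis using F(5) by simp
qed

text \<open>
  The fourth power of the gauge. Unlike the gauge itself it is a polynomial.
\<close>

definition N :: "'g \<Rightarrow> real" where
  "N x = ((norm (hor x))\<^sup>2)\<^sup>2 + 16 * (norm (vert x))\<^sup>2"

text \<open>
  The derivative of \<open>N\<close> along \<open>X\<^sub>e\<close>; see \<open>X_N\<close> below.
\<close>

definition XN :: "'g \<Rightarrow> 'g \<Rightarrow> real" where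
  "XN e x = 4 * (norm (hor x))\<^sup>2 * (hor x \<bullet> e) + 16 * (vert x \<bullet> br (hor x) e)"

lemma N_nonneg: "0 \<le> N x" by (simp add: N_def)

lemma N_eq_0_iff: "N x = 0 \<longleftrightarrow> x = 0"
proof
  assume "N x = 0"
  then have "hor x = 0" "vert x = 0"
    by (simp_all add: N_def add_nonneg_eq_0_iff)
  then show "x = 0" using vert_eq[of x] by simp
next
  have "hor 0 = 0" "vert 0 = 0"
    by (rule linear_0 linear_hor linear_vert)+
  then show "N x = 0" if "x = 0"
    unfolding that by (simp add: N_def)
qed

lemma N_pos: "x \<noteq> 0 \<Longrightarrow> 0 < N x"
  using N_nonneg[of x] N_eq_0_iff[of x] by linarith

lemma bounded_linear_parts: "bounded_linear hor" "bounded_linear vert" "bounded_linear (\<lambda>x. br (hor x) e)"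
  using linear_hor linear_vert linear_compose[OF linear_hor linear_br_left[of e]]
  by (simp_all add: linear_conv_bounded_linear o_def)

lemma C_on_N: "C_on UNIV n N"
  unfolding N_def power2_norm_eq_inner
  by (intro C_on_add C_on_mult C_on_power C_on_const C_on_inner linear_hor linear_vert) auto

lemma C_on_XN: "C_on UNIV n (XN e)"
  unfolding XN_def power2_norm_eq_inner
  using bounded_linear_parts(3)
  by (intro C_on_add C_on_mult C_on_const C_on_inner linear_hor linear_vert C_on_bounded_linear
      bounded_linear_inner_left_comp bounded_linear_parts) (auto intro: bounded_linear.linear)

lemma has_derivative_parts:
  "(hor has_derivative hor) (at x)" "(vert has_derivative vert) (at x)"
  "((\<lambda>x. br (hor x) e) has_derivative (\<lambda>x. br (hor x) e)) (at x)"
  by (intro bounded_linear_imp_has_derivative bounded_linear_parts)+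

lemma has_derivative_N:
  "(N has_derivative (\<lambda>h. 4 * (norm (hor x))\<^sup>2 * (hor x \<bullet> hor h) + 32 * (vert x \<bullet> vert h))) (at x)"
  unfolding N_def[abs_def] power2_norm_eq_inner
  by (rule derivative_eq_intros has_derivative_parts refl)+
    (auto simp: fun_eq_iff inner_commute algebra_simps)

lemma has_derivative_XN:
  "(XN e has_derivative (\<lambda>h. 8 * (hor x \<bullet> hor h) * (hor x \<bullet> e) + 4 * (norm (hor x))\<^sup>2 * (hor h \<bullet> e)
      + 16 * (vert h \<bullet> br (hor x) e + vert x \<bullet> br (hor h) e))) (at x)"
  unfolding XN_def[abs_def] power2_norm_eq_inner
  by (rule derivative_eq_intros has_derivative_parts refl)+
    (auto simp: fun_eq_iff inner_commute algebra_simps)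

lemma X_N: "e \<in> V1 \<Longrightarrow> frechet_derivative N (at x) (X e x) = XN e x"
  by (simp add: frechet_derivative_at[OF has_derivative_N, symmetric] XN_def hor_X vert_X)

text \<open>
  \<open>X\<^sub>e N\<close> is the \<open>e\<close>-component of \<open>4 |v|\<^sup>2 v + 16 J\<^sub>z v\<close>, whose two summands are orthogonal and have
  lengths \<open>4 |v|\<^sup>3\<close> and \<open>16 |z| |v|\<close>. The coefficient 16 in the gauge makes the sum of their squares
  a multiple of \<open>N\<close>.
\<close>

lemma sum_XN_sq: "(\<Sum>e\<in>E. (XN e x)\<^sup>2) = 16 * (norm (hor x))\<^sup>2 * N x"
proof -
  let ?w = "(4 * (norm (hor x))\<^sup>2) *\<^sub>R hor x + 16 *\<^sub>R J (vert x) (hor x)"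
  have "?w \<in> V1"
    by (intro subspace_add[OF subspace_V1] subspace_scale[OF subspace_V1] hor_in J_in)
  moreover have "XN e x = ?w \<bullet> e" if "e \<in> E" for e
    using that by (simp add: XN_def inner_add_left J_inner frame_in)
  ultimately have "(\<Sum>e\<in>E. (XN e x)\<^sup>2) = (norm ?w)\<^sup>2"
    using parseval_frame[of ?w] by simp
  also have "\<dots> = (norm ((4 * (norm (hor x))\<^sup>2) *\<^sub>R hor x))\<^sup>2 + (norm (16 *\<^sub>R J (vert x) (hor x)))\<^sup>2"
    by (rule norm_add_Pythagorean)
      (simp add: orthogonal_def inner_commute[of "hor x"] J_orthogonal hor_in)
  also have "\<dots> = 16 * (norm (hor x))\<^sup>2 * N x"
    by (simp add: power_mult_distrib J_norm vert_in hor_in N_def algebra_simps)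
  finally show ?thesis .
qed

abbreviation Q :: real where "Q \<equiv> real (homogeneous_dim V1 V2)"

text \<open>
  The second derivatives contribute \<open>8 |v|\<^sup>2 + 4 m |v|\<^sup>2\<close> from \<open>|v|\<^sup>4\<close>, and \<open>8 k |v|\<^sup>2\<close> from \<open>16 |z|\<^sup>2\<close> by
  \<open>sum_norm_br\<close>; this is where the homogeneous dimension \<open>Q = m + 2 k\<close> appears.
\<close>

lemma sum_XXN: "(\<Sum>e\<in>E. frechet_derivative (XN e) (at x) (X e x)) = 4 * (Q + 2) * (norm (hor x))\<^sup>2"
proof -
  have "frechet_derivative (XN e) (at x) (X e x) =
      8 * (hor x \<bullet> e)\<^sup>2 + 4 * (norm (hor x))\<^sup>2 + 8 * (norm (br (hor x) e))\<^sup>2" if "e \<in> E" for e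
  proof -
    have "e \<bullet> e = 1" using frame_norm[OF that] by (simp add: norm_eq_1)
    then show ?thesis
      using frame_in[OF that]
      by (simp add: frechet_derivative_at[OF has_derivative_XN, symmetric] hor_X vert_X br_self
          power2_eq_square[of "_ \<bullet> _"] power2_norm_eq_inner[of "br _ _"])
  qed
  then have "(\<Sum>e\<in>E. frechet_derivative (XN e) (at x) (X e x)) =
      (\<Sum>e\<in>E. 8 * (hor x \<bullet> e)\<^sup>2 + 4 * (norm (hor x))\<^sup>2 + 8 * (norm (br (hor x) e))\<^sup>2)"
    by (rule sum.cong[OF refl])
  also have "\<dots> = 8 * (norm (hor x))\<^sup>2 + real (card E) * (4 * (norm (hor x))\<^sup>2)
      + 8 * (real (dim V2) * (norm (hor x))\<^sup>2)"
    by (simp add: sum.distrib parseval_frame hor_in sum_norm_br flip: sum_distrib_left)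
  finally show ?thesis by (simp add: card_frame homogeneous_dim_def algebra_simps)
qed

section \<open>The weighted divergence identity\<close>

lemma continuous_on_X: "continuous_on S (X e)"
  unfolding X_def[abs_def]
  using linear_br_left[of e]
  by (intro continuous_intros linear_continuous_on) (simp add: linear_conv_bounded_linear)

lemma continuous_on_X_derivative:
  "C_on UNIV 1 f \<Longrightarrow> continuous_on S (\<lambda>x. frechet_derivative f (at x) (X e x))"
  by (rule continuous_on_frechet_derivative_field[OF _ continuous_on_X])
    (use C_on_subset[of UNIV 1 f S] in simp)

lemma integrable_off_0:
  assumes "compact C" "0 \<notin> C" "continuous_on (- {0}) u" "\<And>x. x \<notin> C \<Longrightarrow> u x = 0"
  shows "integrable lborel (u :: 'g \<Rightarrow> real)"
  by (rule integrable_compact_support[OF assms(1) continuous_on_subset[OF assms(3)] assms(4)])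
    (use assms(2) in auto)

lemma continuous_on_N_hor:
  "continuous_on S N" "continuous_on S hor" "continuous_on S (XN e)"
  "continuous_on (- {0}) (\<lambda>x. N x powr s)" "continuous_on (- {0}) (\<lambda>x. ln (N x))"
proof -
  show N: "continuous_on S N" for S
    using continuous_on_subset[OF C_on_imp_continuous_on[OF C_on_N[of 0]]] by simp
  show "continuous_on S hor" by (rule linear_continuous_on[OF bounded_linear_parts(1)])
  show "continuous_on S (XN e)"
    using continuous_on_subset[OF C_on_imp_continuous_on[OF C_on_XN[of 0 e]]] by simp
  show "continuous_on (- {0}) (\<lambda>x. N x powr s)" "continuous_on (- {0}) (\<lambda>x. ln (N x))"
    by (intro continuous_intros N; simp add: N_eq_0_iff)+
qed

lemma C_on_real_function_of_N:
  assumes "C_on {0<..} n F"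
  shows "C_on (- {0}) n (\<lambda>x. F (N x))"
  by (rule C_on_compose[OF _ _ assms]) (auto simp: N_pos intro: C_on_subset[OF C_on_N])

lemma frechet_derivative_real_function_of_N:
  assumes "(F has_real_derivative F') (at (N x))"
  shows "((\<lambda>x. F (N x)) has_derivative (\<lambda>h. F' * frechet_derivative N (at x) h)) (at x)"
proof -
  have "(N has_derivative frechet_derivative N (at x)) (at x)"
    by (rule C_on_has_derivative[OF C_on_N]) simp
  from has_derivative_compose[OF this assms[THEN has_field_derivative_imp_has_derivative]]
  show ?thesis .
qed

text \<open>
  The fields \<open>h N\<^sup>s X\<^sub>e N\<close> are integrated by parts along \<open>X\<^sub>e\<close>. When the derivative falls on \<open>N\<^sup>s\<close> and
  on \<open>X\<^sub>e N\<close>, the two geometric identities produce \<open>16 s\<close> and \<open>4 (Q + 2)\<close> times \<open>N\<^sup>s |v|\<^sup>2 h\<close>.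
\<close>

lemma weighted_divergence_theorem:
  fixes s :: real
  assumes h: "C_on UNIV 1 h" and C: "compact C" "0 \<notin> C" "\<And>x. x \<notin> C \<Longrightarrow> h x = 0"
  defines "I1 \<equiv> \<lambda>x. N x powr s * (\<Sum>e\<in>E. frechet_derivative h (at x) (X e x) * XN e x)"
    and "I2 \<equiv> \<lambda>x. N x powr s * (norm (hor x))\<^sup>2 * h x"
  shows "integrable lborel I1" "integrable lborel I2"
    "integral\<^sup>L lborel I1 = - (4 * (4 * s + Q + 2)) * integral\<^sup>L lborel I2"
proof -
  note dh = C1_has_derivative[OF h]
  have dh_out: "frechet_derivative h (at x) k = 0" if "x \<notin> C" for x k
    by (rule has_derivative_zero_outside[OF dh compact_imp_closed[OF C(1)] C(3) that])
  show int1: "integrable lborel I1" unfolding I1_def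
    by (rule integrable_off_0[OF C(1,2)]) (auto intro!: continuous_intros continuous_on_X_derivative[OF h] continuous_on_N_hor simp: dh_out)
  show int2: "integrable lborel I2" unfolding I2_def
    by (rule integrable_off_0[OF C(1,2)]) (auto intro!: continuous_intros C1_continuous_on[OF h] continuous_on_N_hor simp: C(3))
  define f where "f e x = h x * (N x powr s * XN e x)" for e x
  have f_out: "f e x = 0" if "x \<notin> C" for e x using C(3)[OF that] by (simp add: f_def)
  have f_C1: "C_on UNIV 1 (f e)" for e
  proof (rule C_on_extend_by_zero[OF _ compact_imp_closed[OF C(1)] _ _ f_out])
    show "C_on (- {0}) 1 (f e)" unfolding f_def
      by (intro C_on_mult C_on_real_function_of_N C_on_powr C_on_subset[OF h]
          C_on_subset[OF C_on_XN]) auto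
  qed (use C(2) in auto)
  have df: "frechet_derivative (f e) (at x) (X e x) =
      frechet_derivative h (at x) (X e x) * (N x powr s * XN e x) + h x * (s * N x powr (s - 1) * (XN e x)\<^sup>2
        + N x powr s * frechet_derivative (XN e) (at x) (X e x))" if "x \<noteq> 0" "e \<in> E" for e x
  proof -
    have p: "((\<lambda>x. N x powr s) has_derivative
        (\<lambda>k. s * N x powr (s - 1) * frechet_derivative N (at x) k)) (at x)"
      using frechet_derivative_real_function_of_N[OF has_real_derivative_powr[OF N_pos[OF that(1)]], of s] .
    have xn: "(XN e has_derivative frechet_derivative (XN e) (at x)) (at x)"
      by (rule C_on_has_derivative[OF C_on_XN]) simp
    have "(f e has_derivative (\<lambda>k. h x * (N x powr s * frechet_derivative (XN e) (at x) k
        + s * N x powr (s - 1) * frechet_derivative N (at x) k * XN e x)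
        + frechet_derivative h (at x) k * (N x powr s * XN e x))) (at x)"
      unfolding f_def by (rule has_derivative_mult[OF dh has_derivative_mult[OF p xn]])
    from frechet_derivative_at[OF this, symmetric] show ?thesis
      by (simp add: X_N frame_in[OF that(2)] power2_eq_square algebra_simps)
  qed
  have eq: "(\<Sum>e\<in>E. frechet_derivative (f e) (at x) (X e x)) = I1 x + 4 * (4 * s + Q + 2) * I2 x" for x
  proof (cases "x \<in> C")
    case True
    then have x: "x \<noteq> 0" using C(2) by auto
    have N1: "N x powr (s - 1) * N x = N x powr s"
      using N_pos[OF x] by (simp add: powr_diff)
    have "(\<Sum>e\<in>E. frechet_derivative (f e) (at x) (X e x)) =
        I1 x + h x * (s * N x powr (s - 1) * (\<Sum>e\<in>E. (XN e x)\<^sup>2)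
        + N x powr s * (\<Sum>e\<in>E. frechet_derivative (XN e) (at x) (X e x)))"
      by (simp add: df[OF x] I1_def sum.distrib sum_distrib_left distrib_left mult_ac)
    also have "\<dots> = I1 x + h x * (s * 16 * (norm (hor x))\<^sup>2 * (N x powr (s - 1) * N x)
        + N x powr s * (4 * (Q + 2) * (norm (hor x))\<^sup>2))"
      by (simp add: sum_XN_sq sum_XXN)
    finally show ?thesis unfolding N1 I2_def by (simp add: algebra_simps)
  next
    case False
    have "frechet_derivative (f e) (at x) k = 0" for e k
      by (rule has_derivative_zero_outside[OF C_on_has_derivative[of UNIV 0]
            compact_imp_closed[OF C(1)] f_out False]) (use f_C1[of e] in simp_all)
    then show ?thesis using C(3)[OF False] dh_out[OF False] by (simp add: I1_def I2_def)
  qed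
  have X_eq: "X e = (\<lambda>x. e + (1/2) *\<^sub>R br x e)" for e by (simp add: X_def[abs_def])
  have div: "integrable lborel (\<lambda>x. frechet_derivative (f e) (at x) (X e x))"
      "integral\<^sup>L lborel (\<lambda>x. frechet_derivative (f e) (at x) (X e x)) = 0" if "e \<in> E" for e
    using integral_affine_field_eq_0[OF f_C1 C(1) f_out
        linear_compose_scale_right[OF linear_br_left] trace_br[OF frame_in[OF that]]]
    unfolding X_eq by auto
  have "0 = integral\<^sup>L lborel (\<lambda>x. \<Sum>e\<in>E. frechet_derivative (f e) (at x) (X e x))"
    using div by simp
  also have "\<dots> = integral\<^sup>L lborel I1 + 4 * (4 * s + Q + 2) * integral\<^sup>L lborel I2"
    unfolding eq using int1 int2 by simp
  finally show "integral\<^sup>L lborel I1 = - (4 * (4 * s + Q + 2)) * integral\<^sup>L lborel I2"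
    by (simp add: algebra_simps)
qed

section \<open>The Hardy inequality\<close>

lemma K_gauge_powr: "K_gauge V1 V2 x powr \<alpha> = N x powr (\<alpha> / 4)"
  by (simp add: K_gauge_def N_def powr_powr)

lemma K_gauge_pow_4: "K_gauge V1 V2 x ^ 4 = N x"
proof -
  have "K_gauge V1 V2 x = N x powr (1 / 4)" by (simp add: K_gauge_def N_def)
  then show ?thesis using N_nonneg[of x] by (cases "N x = 0") (simp_all add: powr_power)
qed

lemma hardy_integrals:
  fixes \<alpha> :: real
  assumes \<phi>: "C_on UNIV 1 \<phi>" and C: "compact C" "0 \<notin> C" "\<And>x. x \<notin> C \<Longrightarrow> \<phi> x = 0"
  defines "L \<equiv> \<lambda>x. N x powr (\<alpha> / 4) * (\<Sum>e\<in>E. (frechet_derivative \<phi> (at x) (X e x))\<^sup>2)"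
    and "R \<equiv> \<lambda>x. N x powr (\<alpha> / 4 - 1) * (norm (hor x))\<^sup>2 * (\<phi> x)\<^sup>2"
  shows "integrable lborel L" "hardy_lhs br V1 V2 E \<alpha> \<phi> = ennreal (integral\<^sup>L lborel L)"
    "integrable lborel R" "hardy_rhs V1 V2 \<alpha> \<phi> = ennreal (integral\<^sup>L lborel R)"
proof -
  note d\<phi> = C1_has_derivative[OF \<phi>]
  have d\<phi>_out: "frechet_derivative \<phi> (at x) k = 0" if "x \<notin> C" for x k
    by (rule has_derivative_zero_outside[OF d\<phi> compact_imp_closed[OF C(1)] C(3) that])
  show L: "integrable lborel L" unfolding L_def
    by (rule integrable_off_0[OF C(1,2)]) (auto intro!: continuous_intros continuous_on_X_derivative[OF \<phi>] continuous_on_N_hor simp: d\<phi>_out)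
  show R: "integrable lborel R" unfolding R_def
    by (rule integrable_off_0[OF C(1,2)]) (auto intro!: continuous_intros C1_continuous_on[OF \<phi>] continuous_on_N_hor simp: C(3))
  have "K_gauge V1 V2 x powr \<alpha> * hgrad_norm_sq br E \<phi> x = L x" for x
    by (simp add: K_gauge_powr hgrad_norm_sq_def left_inv_field_eq[OF d\<phi>] L_def)
  then show "hardy_lhs br V1 V2 E \<alpha> \<phi> = ennreal (integral\<^sup>L lborel L)"
    unfolding hardy_lhs_def
    by (simp, intro nn_integral_eq_integral L) (simp add: L_def sum_nonneg)
  have "K_gauge V1 V2 x powr \<alpha> * ((norm (hor x))\<^sup>2 / K_gauge V1 V2 x ^ 4) * (\<phi> x)\<^sup>2 = R x" for x
  proof (cases "x = 0")
    case True
    then show ?thesis using C(2,3) by (simp add: R_def)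
  next
    case False
    then show ?thesis using N_pos[OF False]
      by (simp add: K_gauge_powr K_gauge_pow_4 R_def powr_diff)
  qed
  then show "hardy_rhs V1 V2 \<alpha> \<phi> = ennreal (integral\<^sup>L lborel R)"
    unfolding hardy_rhs_def
    by (simp, intro nn_integral_eq_integral R) (simp add: R_def)
qed

text \<open>
  The square completed in the proof is the one that vanishes for the formal minimizer \<open>N\<^sup>-\<^sup>l\<^sup>/\<^sup>4\<close>.
\<close>

theorem hardy_inequality:
  assumes "\<phi> \<in> test_funs"
  shows "ennreal (((Q + \<alpha> - 2) / 2)\<^sup>2) * hardy_rhs V1 V2 \<alpha> \<phi> \<le> hardy_lhs br V1 V2 E \<alpha> \<phi>"
proof -
  define C where "C = closure {x. \<phi> x \<noteq> 0}"
  define l where "l = (Q + \<alpha> - 2) / 2"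
  define s where "s = \<alpha> / 4 - 1"
  let ?D = "\<lambda>e x. frechet_derivative \<phi> (at x) (X e x)"
  have \<phi>: "C_on UNIV 1 \<phi>" and C: "compact C" "0 \<notin> C"
    using assms unfolding test_funs_def C_def C_fun_iff_C_on by blast+
  have out: "\<phi> x = 0" if "x \<notin> C" for x
    using that closure_subset[of "{x. \<phi> x \<noteq> 0}"] by (auto simp: C_def)
  note int = hardy_integrals[OF \<phi> C out, of \<alpha>]
  note d\<phi> = C1_has_derivative[OF \<phi>]
  have dsq: "frechet_derivative (\<lambda>x. (\<phi> x)\<^sup>2) (at x) k = 2 * \<phi> x * frechet_derivative \<phi> (at x) k" for x k
  proof -
    have "((\<lambda>x. (\<phi> x)\<^sup>2) has_derivative (\<lambda>k. 2 * \<phi> x * frechet_derivative \<phi> (at x) k)) (at x)"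
      using has_derivative_power[OF d\<phi>, of 2 x] by (simp add: mult_ac)
    from frechet_derivative_at[OF this, symmetric] show ?thesis by simp
  qed
  have sq: "C_on UNIV 1 (\<lambda>x. (\<phi> x)\<^sup>2)" by (intro C_on_power \<phi>) simp
  have sq_out: "(\<phi> x)\<^sup>2 = 0" if "x \<notin> C" for x using out[OF that] by simp
  have coeff: "4 * (4 * s + Q + 2) = 8 * l" by (simp add: s_def l_def field_simps)
  note div = weighted_divergence_theorem[OF sq C sq_out, of s, unfolded dsq coeff]
  define L where "L x = N x powr (\<alpha> / 4) * (\<Sum>e\<in>E. (?D e x)\<^sup>2)" for x
  define T where "T x = N x powr s * (\<Sum>e\<in>E. 2 * \<phi> x * ?D e x * XN e x)" for x
  define R where "R x = N x powr s * (norm (hor x))\<^sup>2 * (\<phi> x)\<^sup>2" for x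
  have L: "integrable lborel L" "hardy_lhs br V1 V2 E \<alpha> \<phi> = ennreal (integral\<^sup>L lborel L)"
    using int(1,2) by (simp_all add: L_def[abs_def])
  have R: "integrable lborel R" "hardy_rhs V1 V2 \<alpha> \<phi> = ennreal (integral\<^sup>L lborel R)"
    using int(3,4) by (simp_all add: R_def[abs_def] s_def)
  have T: "integrable lborel T" "integral\<^sup>L lborel T = - (8 * l) * integral\<^sup>L lborel R"
    using div(1,3) by (simp_all add: T_def[abs_def] R_def[abs_def])
  have "0 \<le> L x + (l / 4) * T x + l\<^sup>2 * R x" for x
  proof (cases "x = 0")
    case True
    then have "N x = 0" by (simp add: N_eq_0_iff)
    then show ?thesis by (simp add: L_def T_def R_def)
  next
    case False
    note pos = N_pos[OF False]
    \<comment> \<open>Completing the square; \<open>sum_XN_sq\<close> turns its last term into \<open>l\<^sup>2 |v|\<^sup>2 \<phi>\<^sup>2\<close>.\<close>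
    have "(\<Sum>e\<in>E. N x * (?D e x + l * \<phi> x * XN e x / (4 * N x))\<^sup>2) =
        (\<Sum>e\<in>E. N x * (?D e x)\<^sup>2 + (l / 4) * (2 * \<phi> x * ?D e x * XN e x)
          + l\<^sup>2 * (\<phi> x)\<^sup>2 / (16 * N x) * (XN e x)\<^sup>2)"
      using pos by (intro sum.cong refl) (simp add: field_simps power2_eq_square)
    also have "\<dots> = N x * (\<Sum>e\<in>E. (?D e x)\<^sup>2) + (l / 4) * (\<Sum>e\<in>E. 2 * \<phi> x * ?D e x * XN e x)
        + l\<^sup>2 * (\<phi> x)\<^sup>2 / (16 * N x) * (16 * (norm (hor x))\<^sup>2 * N x)"
      by (simp only: sum.distrib sum_distrib_left[symmetric] sum_XN_sq)
    also have "\<dots> = N x * (\<Sum>e\<in>E. (?D e x)\<^sup>2) + (l / 4) * (\<Sum>e\<in>E. 2 * \<phi> x * ?D e x * XN e x)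
        + l\<^sup>2 * (norm (hor x))\<^sup>2 * (\<phi> x)\<^sup>2"
      using pos by simp
    finally have "0 \<le> \<dots>" using pos by (metis (no_types, lifting) sum_nonneg zero_le_mult_iff zero_le_power2 less_imp_le)
    then have "0 \<le> N x powr s * (N x * (\<Sum>e\<in>E. (?D e x)\<^sup>2)
        + (l / 4) * (\<Sum>e\<in>E. 2 * \<phi> x * ?D e x * XN e x) + l\<^sup>2 * (norm (hor x))\<^sup>2 * (\<phi> x)\<^sup>2)"
      by simp
    moreover have "N x powr s * N x = N x powr (\<alpha> / 4)"
      using pos by (simp add: s_def powr_diff)
    then have "L x = N x powr s * N x * (\<Sum>e\<in>E. (?D e x)\<^sup>2)"
      by (simp add: L_def)
    ultimately show ?thesis by (simp add: T_def R_def algebra_simps)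
  qed
  then have "0 \<le> integral\<^sup>L lborel (\<lambda>x. L x + (l / 4) * T x + l\<^sup>2 * R x)"
    by simp
  also have "\<dots> = integral\<^sup>L lborel L + (l / 4) * integral\<^sup>L lborel T + l\<^sup>2 * integral\<^sup>L lborel R"
    using L(1) T(1) R(1) by simp
  finally have "l\<^sup>2 * integral\<^sup>L lborel R \<le> integral\<^sup>L lborel L"
    by (simp add: T(2) power2_eq_square algebra_simps)
  then show ?thesis
    by (simp add: L(2) R(2) ennreal_leI flip: l_def ennreal_mult')
qed

section \<open>Optimality of the constant\<close>

text \<open>
  Integration of \<open>u\<close> against the image of \<open>N\<^sup>q |v|\<^sup>2 dx\<close>, \<open>q = -(Q + 2)/4\<close>, under \<open>ln N\<close>. This
  measure on the line is translation invariant, as \<open>\<nu>_deriv_eq_0\<close> expresses infinitesimally.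
\<close>

definition \<nu> :: "(real \<Rightarrow> real) \<Rightarrow> real" where
  "\<nu> u = (\<integral>x. N x powr (- (Q + 2) / 4) * (norm (hor x))\<^sup>2 * u (ln (N x)) \<partial>lborel)"

lemma compact_N_between: "compact {x. r \<le> N x \<and> N x \<le> R}"
proof -
  have "norm x \<le> 4 + 2 * R" if "N x \<le> R" for x
  proof -
    have sq: "t \<le> 1 + R" if "t\<^sup>2 \<le> R" "0 \<le> t" for t :: real
    proof (cases "t \<le> 1")
      case True
      then show ?thesis using that zero_le_power2[of t] by linarith
    next
      case False
      then have "t * 1 \<le> t * t" by (intro mult_left_mono) auto
      then show ?thesis using that by (simp add: power2_eq_square)
    qed
    have N_eq: "N x = ((norm (hor x))\<^sup>2)\<^sup>2 + (4 * norm (vert x))\<^sup>2"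
      by (simp add: N_def power_mult_distrib)
    have "((norm (hor x))\<^sup>2)\<^sup>2 \<le> R" "(4 * norm (vert x))\<^sup>2 \<le> R"
      using that N_eq zero_le_power2[of "(norm (hor x))\<^sup>2"] zero_le_power2[of "4 * norm (vert x)"]
      by linarith+
    then have *: "(norm (hor x))\<^sup>2 \<le> 1 + R" "4 * norm (vert x) \<le> 1 + R"
      by (auto intro: sq)
    \<comment> \<open>A linear bound on \<open>|v|\<close> from the one on \<open>|v|\<^sup>2\<close>, without square roots.\<close>
    have "0 \<le> (norm (hor x) - 1)\<^sup>2" by simp
    then have "2 * norm (hor x) \<le> 1 + (norm (hor x))\<^sup>2" by (simp add: power2_diff)
    with * have "norm (hor x) \<le> 2 + R" "norm (vert x) \<le> 2 + R"
      using norm_ge_zero[of "vert x"] by linarith+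
    moreover have "norm x \<le> norm (hor x) + norm (vert x)"
      using norm_triangle_ineq[of "hor x" "vert x"] by (simp add: vert_eq[of x])
    ultimately show ?thesis by linarith
  qed
  then have "bounded {x. r \<le> N x \<and> N x \<le> R}" by (auto simp: bounded_iff)
  moreover have "closed {x. r \<le> N x \<and> N x \<le> R}"
    by (intro closed_Collect_conj closed_Collect_le continuous_on_N_hor continuous_on_const)
  ultimately show ?thesis by (simp add: compact_eq_bounded_closed)
qed

definition shell :: "real \<Rightarrow> 'g set" where "shell R = {x. 1 \<le> N x \<and> N x \<le> exp R}"

lemma shell: "compact (shell R)" "0 \<notin> shell R"
  using compact_N_between[of 1 "exp R"] N_eq_0_iff[of 0] by (auto simp: shell_def)

text \<open>
  Profiles are required to vanish outside an open interval starting at \<open>0\<close>. This also covers the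
  origin, because \<open>ln 0 = 0\<close> by convention.
\<close>

lemma off_shell:
  assumes "\<And>t. t \<notin> {0<..<R} \<Longrightarrow> g t = 0" "x \<notin> shell R"
  shows "g (ln (N x)) = (0::real)"
proof (cases "x = 0")
  case True
  then have "N x = 0" by (simp add: N_eq_0_iff)
  then show ?thesis using assms(1)[of 0] by simp
next
  case False
  from assms(2) consider "N x < 1" | "exp R < N x" by (auto simp: shell_def)
  then show ?thesis
  proof cases
    case 1
    then show ?thesis using N_pos[OF False] by (intro assms(1)) auto
  next
    case 2
    then have "R < ln (N x)" using N_pos[OF False] by (metis ln_exp ln_less_cancel_iff exp_gt_zero)
    then show ?thesis by (intro assms(1)) auto
  qed
qed

lemma integrable_\<nu>:
  assumes "continuous_on UNIV u" "\<And>t. t \<notin> {0<..<R} \<Longrightarrow> u t = 0"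
  shows "integrable lborel (\<lambda>x. N x powr (- (Q + 2) / 4) * (norm (hor x))\<^sup>2 * u (ln (N x)))"
proof (rule integrable_off_0[OF shell[of R]])
  show "continuous_on (- {0}) (\<lambda>x. N x powr (- (Q + 2) / 4) * (norm (hor x))\<^sup>2 * u (ln (N x)))"
    by (intro continuous_intros continuous_on_N_hor continuous_on_compose2[OF assms(1)]) auto
next
  fix x assume "x \<notin> shell R"
  from off_shell[of R u, OF assms(2) this]
  show "N x powr (- (Q + 2) / 4) * (norm (hor x))\<^sup>2 * u (ln (N x)) = 0" by simp
qed

text \<open>
  The weighted divergence identity for \<open>h = g(ln N)\<close>, with the exponent for which its right-hand
  side is zero.
\<close>

lemma \<nu>_deriv_eq_0:
  assumes g: "\<And>t. (g has_real_derivative g' t) (at t)" and g': "continuous_on UNIV g'"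
    and out: "\<And>t. t \<notin> {0<..<R} \<Longrightarrow> g t = 0"
  shows "\<nu> g' = 0"
proof -
  define h where "h x = g (ln (N x))" for x
  have h_out: "h x = 0" if "x \<notin> shell R" for x
    unfolding h_def by (rule off_shell[OF out that])
  have "C_on UNIV (Suc 0) g"
    by (rule C_on_real_SucI[OF _ g]) (use g' in simp_all)
  then have "C_on {0<..} 1 (\<lambda>t. g (ln t))"
    by (intro C_on_compose[where T = UNIV, OF _ _ _ C_on_ln]) auto
  then have h: "C_on UNIV 1 h"
    using shell[of R] h_out unfolding h_def
    by (intro C_on_extend_by_zero[OF _ compact_imp_closed[OF shell(1)] _ C_on_real_function_of_N]) auto
  have dh: "frechet_derivative h (at x) (X e x) = g' (ln (N x)) / N x * XN e x"
    if "x \<noteq> 0" "e \<in> E" for e x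
  proof -
    have "((\<lambda>t. g (ln t)) has_real_derivative g' (ln (N x)) * (1 / N x)) (at (N x))"
      by (rule DERIV_chain2[OF g DERIV_ln_divide[OF N_pos[OF that(1)]]])
    from frechet_derivative_at[OF frechet_derivative_real_function_of_N[OF this], symmetric]
    show ?thesis
      by (simp add: h_def[abs_def] X_N frame_in[OF that(2)])
  qed
  define q where "q = - (Q + 2) / 4"
  have eq: "N x powr q * (\<Sum>e\<in>E. frechet_derivative h (at x) (X e x) * XN e x) =
      16 * (N x powr q * (norm (hor x))\<^sup>2 * g' (ln (N x)))" for x
  proof (cases "x = 0")
    case True
    then have "N x = 0" by (simp add: N_eq_0_iff)
    then show ?thesis by simp
  next
    case False
    have "(\<Sum>e\<in>E. frechet_derivative h (at x) (X e x) * XN e x) =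
        g' (ln (N x)) / N x * (\<Sum>e\<in>E. (XN e x)\<^sup>2)"
      by (simp add: dh[OF False] sum_distrib_left power2_eq_square mult_ac)
    then show ?thesis using N_pos[OF False] by (simp add: sum_XN_sq)
  qed
  have "16 * \<nu> g' = integral\<^sup>L lborel
      (\<lambda>x. N x powr q * (\<Sum>e\<in>E. frechet_derivative h (at x) (X e x) * XN e x))"
    unfolding eq by (simp add: \<nu>_def q_def)
  also have "\<dots> = - (4 * (4 * q + Q + 2)) * (\<integral>x. N x powr q * (norm (hor x))\<^sup>2 * h x \<partial>lborel)"
    by (rule weighted_divergence_theorem(3)[OF h shell(1,2)[of R] h_out])
  also have "4 * q + Q + 2 = 0" by (simp add: q_def field_simps)
  finally show ?thesis by simp
qed

text \<open>
  The derivative of \<open>N\<^sup>-\<^sup>l\<^sup>/\<^sup>4 g(ln N)\<close> carries the factor \<open>g' - (l/4) g\<close>. In its square the mixed term is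
  a multiple of \<open>(g\<^sup>2)'\<close> and integrates to zero against \<open>\<nu>\<close>.
\<close>

lemma hardy_integrals_profile:
  fixes \<alpha> :: real
  assumes g: "\<And>n. C_on UNIV n g" "\<And>t. (g has_real_derivative g' t) (at t)" "continuous_on UNIV g'"
    and out: "\<And>t. t \<notin> {0<..<R} \<Longrightarrow> g t = 0" "\<And>t. t \<notin> {0<..<R} \<Longrightarrow> g' t = 0"
  defines "l \<equiv> (Q + \<alpha> - 2) / 2"
  defines "\<phi> \<equiv> \<lambda>x. N x powr (- l / 4) * g (ln (N x))"
  shows "\<phi> \<in> test_funs"
    "hardy_lhs br V1 V2 E \<alpha> \<phi> = ennreal (16 * \<nu> (\<lambda>t. (g' t)\<^sup>2) + l\<^sup>2 * \<nu> (\<lambda>t. (g t)\<^sup>2))"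
    "hardy_rhs V1 V2 \<alpha> \<phi> = ennreal (\<nu> (\<lambda>t. (g t)\<^sup>2))"
proof -
  define q where "q = - (Q + 2) / 4"
  define F where "F t = t powr (- l / 4) * g (ln t)" for t
  have \<phi>_F: "\<phi> = (\<lambda>x. F (N x))" by (simp add: \<phi>_def F_def)
  have \<phi>_out: "\<phi> x = 0" if "x \<notin> shell R" for x
    using off_shell[of R g, OF out(1) that] by (simp add: \<phi>_def)
  have "C_on {0<..} n F" for n unfolding F_def
    by (intro C_on_mult C_on_powr C_on_compose[where T = UNIV, OF _ _ g(1) C_on_ln]) auto
  then have smooth: "C_on UNIV n \<phi>" for n
    using shell[of R] \<phi>_out unfolding \<phi>_F
    by (intro C_on_extend_by_zero[OF _ compact_imp_closed[OF shell(1)] _ C_on_real_function_of_N]) auto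
  have "closure {x. \<phi> x \<noteq> 0} \<subseteq> shell R"
    using \<phi>_out by (intro closure_minimal compact_imp_closed shell) auto
  then show "\<phi> \<in> test_funs"
    using smooth shell[of R] unfolding test_funs_def C_fun_iff_C_on
    by (auto simp: compact_eq_bounded_closed intro: bounded_subset)
  note int = hardy_integrals[OF smooth[of 1] shell(1,2)[of R] \<phi>_out, of \<alpha>]
  have g_cont: "continuous_on UNIV g"
    using C_on_imp_continuous_on[OF g(1)[of 0]] .
  have d\<phi>: "frechet_derivative \<phi> (at x) (X e x) =
      N x powr (- l / 4 - 1) * (g' (ln (N x)) - l / 4 * g (ln (N x))) * XN e x"
    if "x \<noteq> 0" "e \<in> E" for e x
  proof -
    note pos = N_pos[OF that(1)]
    have 1: "((\<lambda>t. g (ln t)) has_real_derivative g' (ln (N x)) * (1 / N x)) (at (N x))"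
      by (rule DERIV_chain2[OF g(2) DERIV_ln_divide[OF pos]])
    have 2: "((\<lambda>t. t powr (- l / 4)) has_real_derivative (- l / 4) * N x powr (- l / 4 - 1)) (at (N x))"
      by (rule has_real_derivative_powr[OF pos])
    have "(F has_real_derivative N x powr (- l / 4 - 1) * (g' (ln (N x)) - l / 4 * g (ln (N x)))) (at (N x))"
      unfolding F_def
    proof (rule DERIV_cong[OF DERIV_mult[OF 2 1]])
      have "N x powr (- l / 4) = N x * N x powr (- l / 4 - 1)"
        using pos by (simp add: powr_diff)
      then show "- l / 4 * N x powr (- l / 4 - 1) * g (ln (N x)) + g' (ln (N x)) * (1 / N x) * N x powr (- l / 4)
          = N x powr (- l / 4 - 1) * (g' (ln (N x)) - l / 4 * g (ln (N x)))"
        using pos by (simp only:) (simp add: algebra_simps)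
    qed
    from frechet_derivative_at[OF frechet_derivative_real_function_of_N[OF this], symmetric]
    show ?thesis
      by (simp add: \<phi>_F X_N frame_in[OF that(2)])
  qed
  have L: "N x powr (\<alpha> / 4) * (\<Sum>e\<in>E. (frechet_derivative \<phi> (at x) (X e x))\<^sup>2) =
      16 * (N x powr q * (norm (hor x))\<^sup>2 * (g' (ln (N x)))\<^sup>2)
      - 4 * l * (N x powr q * (norm (hor x))\<^sup>2 * (2 * g (ln (N x)) * g' (ln (N x))))
      + l\<^sup>2 * (N x powr q * (norm (hor x))\<^sup>2 * (g (ln (N x)))\<^sup>2)" (is "_ = ?r") for x
  proof (cases "x = 0")
    case True
    then have "N x = 0" by (simp add: N_eq_0_iff)
    then show ?thesis by simp
  next
    case False
    note pos = N_pos[OF False]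
    let ?w = "g' (ln (N x)) - l / 4 * g (ln (N x))"
    have "N x powr (\<alpha> / 4) * (\<Sum>e\<in>E. (frechet_derivative \<phi> (at x) (X e x))\<^sup>2) =
        N x powr (\<alpha> / 4) * ((N x powr (- l / 4 - 1))\<^sup>2 * ?w\<^sup>2 * (\<Sum>e\<in>E. (XN e x)\<^sup>2))"
      by (simp add: d\<phi>[OF False] sum_distrib_left power_mult_distrib)
    also have "\<dots> = N x powr (\<alpha> / 4) * (N x powr (- l / 4 - 1))\<^sup>2 * N x powr 1 * (16 * (norm (hor x))\<^sup>2 * ?w\<^sup>2)"
      using pos by (simp add: sum_XN_sq)
    also have "N x powr (\<alpha> / 4) * (N x powr (- l / 4 - 1))\<^sup>2 * N x powr 1 = N x powr q"
    proof -
      have "\<alpha> / 4 + 2 * (- l / 4 - 1) + 1 = q" by (simp add: l_def q_def field_simps)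
      moreover have "(N x powr (- l / 4 - 1))\<^sup>2 = N x powr (2 * (- l / 4 - 1))"
        using pos by (simp add: powr_power)
      ultimately show ?thesis by (simp only: powr_add[symmetric])
    qed
    also have "N x powr q * (16 * (norm (hor x))\<^sup>2 * ?w\<^sup>2) = ?r"
      by (simp add: power2_eq_square field_simps)
    finally show ?thesis .
  qed
  have R: "N x powr (\<alpha> / 4 - 1) * (norm (hor x))\<^sup>2 * (\<phi> x)\<^sup>2 =
      N x powr q * (norm (hor x))\<^sup>2 * (g (ln (N x)))\<^sup>2" for x
  proof (cases "x = 0")
    case True
    then have "N x = 0" by (simp add: N_eq_0_iff)
    then show ?thesis by simp
  next
    case False
    note pos = N_pos[OF False]
    have "\<alpha> / 4 - 1 + 2 * (- l / 4) = q" by (simp add: l_def q_def field_simps)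
    moreover have "(N x powr (- l / 4))\<^sup>2 = N x powr (2 * (- l / 4))"
      using pos by (simp add: powr_power)
    ultimately have "N x powr (\<alpha> / 4 - 1) * (N x powr (- l / 4))\<^sup>2 = N x powr q"
      by (simp only: powr_add[symmetric])
    then show ?thesis by (simp add: \<phi>_def power_mult_distrib mult_ac)
  qed
  have i1: "integrable lborel (\<lambda>x. N x powr q * (norm (hor x))\<^sup>2 * (g' (ln (N x)))\<^sup>2)"
    unfolding q_def by (rule integrable_\<nu>[of "\<lambda>t. (g' t)\<^sup>2" R]) (auto intro!: continuous_intros g(3) simp: out)
  have i2: "integrable lborel (\<lambda>x. N x powr q * (norm (hor x))\<^sup>2 * (2 * g (ln (N x)) * g' (ln (N x))))"
    unfolding q_def by (rule integrable_\<nu>[of "\<lambda>t. 2 * g t * g' t" R]) (auto intro!: continuous_intros g(3) g_cont simp: out)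
  have i3: "integrable lborel (\<lambda>x. N x powr q * (norm (hor x))\<^sup>2 * (g (ln (N x)))\<^sup>2)"
    unfolding q_def by (rule integrable_\<nu>[of "\<lambda>t. (g t)\<^sup>2" R]) (auto intro!: continuous_intros g_cont simp: out)
  have lin: "(\<integral>x. 16 * u x - 4 * l * v x + l\<^sup>2 * w x \<partial>lborel)
      = 16 * integral\<^sup>L lborel u - 4 * l * integral\<^sup>L lborel v + l\<^sup>2 * integral\<^sup>L lborel w"
    if "integrable lborel u" "integrable lborel v" "integrable lborel w" for u v w :: "'g \<Rightarrow> real"
    using that by simp
  have "\<nu> (\<lambda>t. 2 * g t * g' t) = 0"
    by (rule \<nu>_deriv_eq_0[of "\<lambda>t. (g t)\<^sup>2" _ R])
      (auto intro!: derivative_eq_intros g continuous_intros g_cont simp: out)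
  moreover have \<nu>_q: "\<nu> u = (\<integral>x. N x powr q * (norm (hor x))\<^sup>2 * u (ln (N x)) \<partial>lborel)" for u
    by (simp only: \<nu>_def q_def)
  ultimately have "(\<integral>x. N x powr (\<alpha> / 4) * (\<Sum>e\<in>E. (frechet_derivative \<phi> (at x) (X e x))\<^sup>2) \<partial>lborel)
      = 16 * \<nu> (\<lambda>t. (g' t)\<^sup>2) + l\<^sup>2 * \<nu> (\<lambda>t. (g t)\<^sup>2)"
    unfolding L \<nu>_q lin[OF i1 i2 i3] by simp
  then show "hardy_lhs br V1 V2 E \<alpha> \<phi> = ennreal (16 * \<nu> (\<lambda>t. (g' t)\<^sup>2) + l\<^sup>2 * \<nu> (\<lambda>t. (g t)\<^sup>2))"
    using int(2) by simp
  have "(\<integral>x. N x powr (\<alpha> / 4 - 1) * (norm (hor x))\<^sup>2 * (\<phi> x)\<^sup>2 \<partial>lborel) = \<nu> (\<lambda>t. (g t)\<^sup>2)"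
    unfolding R \<nu>_q ..
  then show "hardy_rhs V1 V2 \<alpha> \<phi> = ennreal (\<nu> (\<lambda>t. (g t)\<^sup>2))"
    using int(4) by simp
qed

lemma frame_nonempty: "E \<noteq> {}"
proof
  assume "E = {}"
  then have V1: "V1 = {0}" using frame by (simp add: orthonormal_basis_of_def)
  have "br 0 0 = 0" by (rule br_self)
  then have "V2 = {0}" using br_V1_V1 by (auto simp: V1)
  then have "(UNIV :: 'g set) = {0}" using V1_plus_V2 by (auto simp: V1)
  then show False using nonempty_Basis nonzero_Basis by blast
qed

text \<open>
  A multiple of a frame vector realizes any prescribed value of \<open>ln N\<close> at a point with \<open>v \<noteq> 0\<close>, so
  the nonnegative continuous integrand is positive somewhere.
\<close>

lemma \<nu>_pos:
  assumes u: "continuous_on UNIV u" "\<And>t. t \<notin> {0<..<R} \<Longrightarrow> u t = 0" "\<And>t. 0 \<le> u t" "0 < u t0"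
  shows "0 < \<nu> u"
proof -
  define I where "I x = N x powr (- (Q + 2) / 4) * (norm (hor x))\<^sup>2 * u (ln (N x))" for x
  have int: "integrable lborel I" unfolding I_def by (rule integrable_\<nu>[OF u(1,2)])
  have nn: "0 \<le> I x" for x by (simp add: I_def u(3))
  define S where "S = {x \<in> - {0}. 0 < I x}"
  have "open S"
  proof -
    have "continuous_on (- {0}) I" unfolding I_def
      by (intro continuous_intros continuous_on_N_hor continuous_on_compose2[OF u(1)]) auto
    then have "open (- {0} \<inter> I -` {0<..})"
      by (rule continuous_open_preimage) auto
    moreover have "- {0} \<inter> I -` {0<..} = S" by (auto simp: S_def)
    ultimately show ?thesis by simp
  qed
  obtain e where e: "e \<in> E" using frame_nonempty by blast
  define x0 where "x0 = exp (t0 / 4) *\<^sub>R e"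
  have x0: "x0 \<in> V1" unfolding x0_def by (intro subspace_scale[OF subspace_V1] frame_in e)
  have "norm x0 = exp (t0 / 4)" by (simp add: x0_def frame_norm[OF e])
  then have "N x0 = exp (t0 / 4) ^ 4" using x0 by (simp add: N_def hor_V1 vert_V1)
  also have "\<dots> = exp t0" by (simp flip: exp_of_nat_mult)
  finally have N0: "N x0 = exp t0" .
  have "x0 \<noteq> 0" using N_eq_0_iff[of x0] by (simp add: N0)
  then have "x0 \<in> S" using x0 u(4) by (simp add: S_def I_def N0 hor_V1)
  with \<open>open S\<close> have "\<not> negligible S" by (intro open_not_negligible) auto
  then have "S \<notin> null_sets lborel"
    by (auto simp: negligible_iff_null_sets intro: null_sets_completionI)
  moreover have "S \<in> sets lborel" using \<open>open S\<close> by simp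
  ultimately have "\<not> (AE x in lborel. x \<notin> S)" by (simp add: AE_iff_null_sets)
  moreover have "AE x in lborel. x \<notin> S" if "AE x in lborel. I x = 0"
    using that by eventually_elim (simp add: S_def)
  ultimately have "\<not> (AE x in lborel. I x = 0)" by blast
  then have "integral\<^sup>L lborel I \<noteq> 0"
    using integral_nonneg_eq_0_iff_AE[OF int] nn by simp
  moreover have "0 \<le> integral\<^sup>L lborel I" using nn by simp
  ultimately show ?thesis by (simp add: \<nu>_def I_def[abs_def])
qed

lemma \<nu>_mono:
  assumes "continuous_on UNIV u" "\<And>t. t \<notin> {0<..<R} \<Longrightarrow> u t = 0"
    "continuous_on UNIV v" "\<And>t. t \<notin> {0<..<R} \<Longrightarrow> v t = 0" "\<And>t. u t \<le> v t"
  shows "\<nu> u \<le> \<nu> v"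
  unfolding \<nu>_def
  by (intro integral_mono integrable_\<nu>[OF assms(1,2)] integrable_\<nu>[OF assms(3,4)] mult_left_mono assms(5)) auto

lemma \<nu>_cmult: "\<nu> (\<lambda>t. c * u t) = c * \<nu> u"
  unfolding \<nu>_def by (simp add: mult.left_commute[of _ c])

lemma \<nu>_add:
  assumes "continuous_on UNIV u" "\<And>t. t \<notin> {0<..<R} \<Longrightarrow> u t = 0"
    "continuous_on UNIV v" "\<And>t. t \<notin> {0<..<R} \<Longrightarrow> v t = 0"
  shows "\<nu> (\<lambda>t. u t + v t) = \<nu> u + \<nu> v"
  using integrable_\<nu>[OF assms(1,2)] integrable_\<nu>[OF assms(3,4)]
  unfolding \<nu>_def by (simp add: distrib_left)

text \<open>
  The profile is the plateau \<open>B(t) - B(t - n - 1)\<close> built from the smooth step \<open>B\<close> with derivative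
  \<open>b \<le> M\<close>. Write \<open>m\<close> for the integral of \<open>b\<close>, which is also that of all its translates. The squared
  derivative is at most \<open>M\<close> times the sum of two translates of \<open>b\<close> and thus has integral at most \<open>2 M m\<close>. On
  the top of the plateau fit \<open>n\<close> translates of \<open>b\<close> with disjoint supports, which bounds the integral
  of the squared profile below by \<open>n m / M\<close>.
\<close>

theorem hardy_constant_optimal:
  assumes "((Q + \<alpha> - 2) / 2)\<^sup>2 < C"
  obtains \<phi> where "\<phi> \<in> test_funs" "\<not> ennreal C * hardy_rhs V1 V2 \<alpha> \<phi> \<le> hardy_lhs br V1 V2 E \<alpha> \<phi>"
proof -
  define l where "l = (Q + \<alpha> - 2) / 2"
  obtain B b :: "real \<Rightarrow> real" and M where
    B: "\<And>n. C_on UNIV n B" "\<And>t. (B has_real_derivative b t) (at t)" and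
    b: "continuous_on UNIV b" "\<And>t. 0 \<le> b t" "\<And>t. b t \<le> M" "\<And>t. t \<notin> {0<..<1} \<Longrightarrow> b t = 0" and
    B01: "\<And>t. t \<le> 0 \<Longrightarrow> B t = 0" "\<And>t. 1 \<le> t \<Longrightarrow> B t = 1"
    using smooth_step_exists by metis
  have M: "0 \<le> M" using b(2)[of 0] b(3)[of 0] by linarith
  have b_shift: "continuous_on UNIV (\<lambda>t. b (t - r))" for r
    by (intro continuous_on_compose2[OF b(1)] continuous_intros) auto
  have B_shift: "((\<lambda>t. B (t - r)) has_real_derivative b (t - r)) (at t)" for r t
  proof -
    have "((\<lambda>t. t - r) has_real_derivative 1) (at t)" by (auto intro!: derivative_eq_intros)
    from DERIV_chain2[OF B(2) this] show ?thesis by simp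
  qed
  obtain t0 where t0: "0 < b t0"
  proof -
    have "\<exists>z>0. z < 1 \<and> B 1 - B 0 = (1 - 0) * b z"
      by (rule MVT2) (auto intro: B(2))
    then obtain z where "b z = 1" using B01(1)[of 0] B01(2)[of 1] by auto
    then show ?thesis using that[of z] by simp
  qed
  define m where "m = \<nu> b"
  have m: "0 < m" unfolding m_def by (rule \<nu>_pos[OF b(1,4,2) t0])
  have m_shift: "\<nu> (\<lambda>t. b (t - real j)) = m" for j
  proof -
    \<comment> \<open>The difference of two translates of \<open>b\<close> is the derivative of the compactly supported function
      \<open>B(t) - B(t - j)\<close>.\<close>
    have "\<nu> (\<lambda>t. b t + (- 1) * b (t - real j)) = 0"
      by (rule \<nu>_deriv_eq_0[of "\<lambda>t. B t + (- 1) * B (t - real j)" _ "real j + 1"])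
        (auto intro!: derivative_eq_intros B B_shift continuous_intros b(1) b_shift simp: B01)
    moreover have "\<nu> (\<lambda>t. b t + (- 1) * b (t - real j)) = m + \<nu> (\<lambda>t. (- 1) * b (t - real j))"
      unfolding m_def
      by (rule \<nu>_add[of _ "real j + 1"]) (auto intro!: continuous_intros b(1) b_shift simp: b(4))
    ultimately show ?thesis using \<nu>_cmult[of "-1" "\<lambda>t. b (t - real j)"] by simp
  qed
  \<comment> \<open>Past this length the lower bound \<open>(C - l\<^sup>2) n m / M\<close> exceeds the bound \<open>32 M m\<close> for
    \<open>16 \<integral> g'\<^sup>2 d\<nu>\<close>.\<close>
  obtain n :: nat where n: "32 * M\<^sup>2 / (C - l\<^sup>2) < real n" using reals_Archimedean2 by blast
  define g where "g t = B t - B (t - real (Suc n))" for t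
  define g' where "g' t = b t - b (t - real (Suc n))" for t
  define R where "R = real n + 2"
  have g: "C_on UNIV k g" for k
  proof -
    have "C_on UNIV k (\<lambda>t::real. t - real (Suc n))"
      by (intro C_on_diff C_on_const C_on_bounded_linear bounded_linear_ident) auto
    then have "C_on UNIV k (\<lambda>t. B (t - real (Suc n)))"
      by (intro C_on_compose[where T = UNIV, OF _ _ B(1)]) auto
    then show ?thesis unfolding g_def by (intro C_on_diff B(1)) auto
  qed
  have g_deriv: "(g has_real_derivative g' t) (at t)" for t
    unfolding g_def g'_def by (intro DERIV_diff B B_shift)
  have g'_cont: "continuous_on UNIV g'"
    unfolding g'_def by (intro continuous_intros b(1) b_shift)
  have g_cont: "continuous_on UNIV g" using C_on_imp_continuous_on[OF g[of 0]] .
  have out: "g t = 0" "g' t = 0" if "t \<notin> {0<..<R}" for t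
    using that by (auto simp: g_def g'_def R_def B01 b(4))
  define \<phi> where "\<phi> = (\<lambda>x. N x powr (- l / 4) * g (ln (N x)))"
  note profile = hardy_integrals_profile[where \<alpha> = \<alpha> and R = R, OF g g_deriv g'_cont out,
      folded l_def, folded \<phi>_def]
  have \<phi>: "\<phi> \<in> test_funs" by (rule profile(1))
  have lhs: "hardy_lhs br V1 V2 E \<alpha> \<phi> = ennreal (16 * \<nu> (\<lambda>t. (g' t)\<^sup>2) + l\<^sup>2 * \<nu> (\<lambda>t. (g t)\<^sup>2))"
    by (rule profile(2))
  have rhs: "hardy_rhs V1 V2 \<alpha> \<phi> = ennreal (\<nu> (\<lambda>t. (g t)\<^sup>2))"
    by (rule profile(3))
  have g'_bound: "\<nu> (\<lambda>t. (g' t)\<^sup>2) \<le> 2 * M * m"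
  proof -
    have "\<nu> (\<lambda>t. (g' t)\<^sup>2) \<le> \<nu> (\<lambda>t. M * (b t + b (t - real (Suc n))))"
    proof (rule \<nu>_mono[of _ R])
      fix t
      have sq: "p\<^sup>2 \<le> M * p" if "0 \<le> p" "p \<le> M" for p
        using mult_right_mono[OF that(2,1)] by (simp add: power2_eq_square)
      have "(g' t)\<^sup>2 \<le> (b t)\<^sup>2 + (b (t - real (Suc n)))\<^sup>2"
        using b(2) by (simp add: g'_def power2_diff)
      also have "\<dots> \<le> M * b t + M * b (t - real (Suc n))"
        by (intro add_mono sq b)
      finally show "(g' t)\<^sup>2 \<le> M * (b t + b (t - real (Suc n)))" by (simp add: distrib_left)
    qed (auto intro!: continuous_intros g'_cont b(1) b_shift simp: out b(4) R_def)
    also have "\<dots> = M * (m + m)"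
    proof -
      have "\<nu> (\<lambda>t. b t + b (t - real (Suc n))) = \<nu> b + \<nu> (\<lambda>t. b (t - real (Suc n)))"
        by (rule \<nu>_add[of _ R]) (auto intro!: b(1) b_shift simp: b(4) R_def)
      then show ?thesis by (simp only: \<nu>_cmult m_shift m_def)
    qed
    finally show ?thesis by simp
  qed
  have g_bound: "real n * m \<le> M * \<nu> (\<lambda>t. (g t)\<^sup>2)"
  proof -
    define S where "S k t = (\<Sum>j<k. b (t - real (Suc j)))" for k t
    have S_cont: "continuous_on UNIV (S k)" for k
      unfolding S_def by (intro continuous_intros b_shift)
    have S_out: "S k t = 0" if "t \<notin> {1<..<real k + 1}" for k t
      unfolding S_def using that by (intro sum.neutral ballI b(4)) auto
    have S_le: "S k t \<le> M" for k t
    proof (induction k)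
      case (Suc k)
      show ?case
      proof (cases "t \<le> real k + 1")
        case True
        then have "b (t - real (Suc k)) = 0" by (intro b(4)) auto
        then show ?thesis using Suc by (simp add: S_def)
      next
        case False
        then have "S k t = 0" by (intro S_out) auto
        then show ?thesis using b(3)[of "t - real (Suc k)"] by (simp add: S_def)
      qed
    qed (use M in \<open>simp add: S_def\<close>)
    have "real k * m = \<nu> (S k)" if "k \<le> n" for k
      using that
    proof (induction k)
      case 0
      show ?case by (simp add: S_def \<nu>_def)
    next
      case (Suc k)
      have "\<nu> (S (Suc k)) = \<nu> (\<lambda>t. S k t + b (t - real (Suc k)))"
        by (rule arg_cong[of _ _ \<nu>]) (simp add: S_def fun_eq_iff)
      also have "\<dots> = \<nu> (S k) + \<nu> (\<lambda>t. b (t - real (Suc k)))"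
        by (rule \<nu>_add[of _ R]) (use Suc.prems in \<open>auto intro!: S_cont b_shift S_out b(4) simp: R_def\<close>)
      finally show ?case using Suc by (simp only: m_shift) (simp add: distrib_right)
    qed
    then have "real n * m = \<nu> (S n)" by simp
    also have "\<dots> \<le> \<nu> (\<lambda>t. M * (g t)\<^sup>2)"
    proof (rule \<nu>_mono[of _ R])
      show "S n t \<le> M * (g t)\<^sup>2" for t
      proof (cases "t \<in> {1<..<real n + 1}")
        case True
        then have "g t = 1" by (simp add: g_def B01)
        then show ?thesis using S_le by simp
      next
        case False
        then show ?thesis using S_out[OF False] M by simp
      qed
    qed (auto intro!: S_cont continuous_intros g_cont S_out simp: R_def out[unfolded R_def])
    finally show ?thesis by (simp only: \<nu>_cmult)
  qed
  have pos: "0 < C - l\<^sup>2" using assms by (simp add: l_def)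
  have nn: "0 \<le> \<nu> (\<lambda>t. (g t)\<^sup>2)" "0 \<le> \<nu> (\<lambda>t. (g' t)\<^sup>2)"
    by (simp_all add: \<nu>_def)
  have "\<not> C * \<nu> (\<lambda>t. (g t)\<^sup>2) \<le> 16 * \<nu> (\<lambda>t. (g' t)\<^sup>2) + l\<^sup>2 * \<nu> (\<lambda>t. (g t)\<^sup>2)"
  proof
    assume "C * \<nu> (\<lambda>t. (g t)\<^sup>2) \<le> 16 * \<nu> (\<lambda>t. (g' t)\<^sup>2) + l\<^sup>2 * \<nu> (\<lambda>t. (g t)\<^sup>2)"
    then have "(C - l\<^sup>2) * \<nu> (\<lambda>t. (g t)\<^sup>2) \<le> 32 * M * m"
      using g'_bound by (simp add: left_diff_distrib)
    then have "M * ((C - l\<^sup>2) * \<nu> (\<lambda>t. (g t)\<^sup>2)) \<le> M * (32 * M * m)"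
      using M by (rule mult_left_mono)
    moreover have "(C - l\<^sup>2) * (real n * m) \<le> (C - l\<^sup>2) * (M * \<nu> (\<lambda>t. (g t)\<^sup>2))"
      using g_bound pos by (intro mult_left_mono) auto
    ultimately have "((C - l\<^sup>2) * real n) * m \<le> (32 * M\<^sup>2) * m"
      by (simp add: power2_eq_square mult_ac)
    then have "(C - l\<^sup>2) * real n \<le> 32 * M\<^sup>2" using m by simp
    with n pos show False by (simp add: field_simps)
  qed
  then have "\<not> ennreal (C * \<nu> (\<lambda>t. (g t)\<^sup>2))
      \<le> ennreal (16 * \<nu> (\<lambda>t. (g' t)\<^sup>2) + l\<^sup>2 * \<nu> (\<lambda>t. (g t)\<^sup>2))"
    by (subst ennreal_le_iff) (use nn in auto)
  moreover have "0 \<le> C" using pos zero_le_power2[of l] by linarith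
  then have "ennreal (C * \<nu> (\<lambda>t. (g t)\<^sup>2)) = ennreal C * hardy_rhs V1 V2 \<alpha> \<phi>"
    unfolding rhs using nn(1) by (rule ennreal_mult)
  ultimately show ?thesis
    by (intro that[OF \<phi>]) (simp only: lhs not_False_eq_True)
qed

end

theorem theorem3p2:
  fixes br :: "'g::euclidean_space \<Rightarrow> 'g \<Rightarrow> 'g"
    and V1 V2 E :: "'g set"
    and \<alpha> :: real
  assumes "H_type_algebra br V1 V2"
    and "orthonormal_basis_of E V1"
  defines "c \<equiv> ((real (homogeneous_dim V1 V2) + \<alpha> - 2) / 2)\<^sup>2"
  shows "(\<forall>\<phi>\<in>test_funs. hardy_lhs br V1 V2 E \<alpha> \<phi> \<ge> ennreal c * hardy_rhs V1 V2 \<alpha> \<phi>) \<and>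
    (\<forall>C>c. \<not> (\<forall>\<phi>\<in>test_funs. hardy_lhs br V1 V2 E \<alpha> \<phi> \<ge> ennreal C * hardy_rhs V1 V2 \<alpha> \<phi>))"
proof -
  interpret H_type_frame br V1 V2 E
    using assms(1,2) by (simp add: H_type_frame_def H_type_frame_axioms_def)
  show ?thesis
    unfolding c_def using hardy_inequality hardy_constant_optimal by metis
qed

end
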